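(* Let $G$ be a finite soluble group such that $w(G) \geq 4$. Then there exist $p, q \in \pi(G)$ with $p \neq q$ such that $$h(G) \leq h(G_{p'}) + h(G_{q'}) - 1.$$
   Context: For a finite soluble group $G$: $\pi(G)$ is the set of prime divisors of $|G|$ and $w(G)=|\pi(G)|$; $h(G)$ is the Fitting length (nilpotent length) of $G$, with $h(1)=0$. For $p \in \pi(G)$, $G_{p'}$ denotes a Hall subgroup of $G$ for the set of primes $\pi(G)\setminus\{p\}$ (a subgroup of order prime to $p$ whose index is a power of $p$; it is unique up to conjugacy, so $h(G_{p'})$ is well defined). *)

theory Defs
  imports "HOL-Algebra.Algebra" "HOL-Computational_Algebra.Primes"
begin

definition group_primes :: "('a, 'b) monoid_scheme \<Rightarrow> nat set"
  where "group_primes G = prime_factors (order G)"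

definition hall_subgroup :: "nat set \<Rightarrow> 'a set \<Rightarrow> ('a, 'b) monoid_scheme \<Rightarrow> bool"
  where "hall_subgroup \<pi> H G \<longleftrightarrow>
    subgroup H G \<and> prime_factors (card H) \<subseteq> \<pi> \<and>
    prime_factors (card (rcosets\<^bsub>G\<^esub> H)) \<inter> \<pi> = {}"

definition commutator_subgroup :: "('a, 'b) monoid_scheme \<Rightarrow> 'a set \<Rightarrow> 'a set \<Rightarrow> 'a set"
  where "commutator_subgroup G A B =
    generate G (\<Union>a \<in> A. \<Union>b \<in> B. {a \<otimes>\<^bsub>G\<^esub> b \<otimes>\<^bsub>G\<^esub> inv\<^bsub>G\<^esub> a \<otimes>\<^bsub>G\<^esub> inv\<^bsub>G\<^esub> b})"

definition lower_central :: "('a, 'b) monoid_scheme \<Rightarrow> nat \<Rightarrow> 'a set"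
  where "lower_central G n =
    ((\<lambda>K. commutator_subgroup G K (carrier G)) ^^ n) (carrier G)"

definition nilpotent_group :: "('a, 'b) monoid_scheme \<Rightarrow> bool"
  where "nilpotent_group G \<longleftrightarrow> (\<exists>n. lower_central G n = {\<one>\<^bsub>G\<^esub>})"

text \<open>\<open>nilpotent_series G n H\<close>: there is a series
  \<open>{\<one>} = H\<^sub>0 \<subseteq> \<dots> \<subseteq> H\<^sub>n = H\<close> of subgroups of \<open>G\<close>, each normal in the next, with
  nilpotent factors. Inclusions need not be strict, which does not affect the minimal length.\<close>

inductive nilpotent_series :: "('a, 'b) monoid_scheme \<Rightarrow> nat \<Rightarrow> 'a set \<Rightarrow> bool"
  for G where
    unity: "nilpotent_series G 0 {\<one>\<^bsub>G\<^esub>}"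
  | extension: "\<lbrakk> nilpotent_series G n K; K \<lhd> (G\<lparr>carrier := H\<rparr>); subgroup H G;
                  nilpotent_group ((G\<lparr>carrier := H\<rparr>) Mod K) \<rbrakk>
                \<Longrightarrow> nilpotent_series G (Suc n) H"

text \<open>Only meaningful when some nilpotent series exists; for solvable groups this is
  \<open>solvable_imp_nilpotent_series\<close> below.\<close>

definition fitting_length :: "('a, 'b) monoid_scheme \<Rightarrow> nat"
  where "fitting_length G = (LEAST n. nilpotent_series G n (carrier G))"

lemma comm_group_imp_nilpotent_group:
  assumes "comm_group G"
  shows "nilpotent_group G"
proof -
  interpret comm_group G by fact
  have "(\<Union>a \<in> carrier G. \<Union>b \<in> carrier G. {a \<otimes>\<^bsub>G\<^esub> b \<otimes>\<^bsub>G\<^esub> inv\<^bsub>G\<^esub> a \<otimes>\<^bsub>G\<^esub> inv\<^bsub>G\<^esub> b})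
      = derived_set G (carrier G)"
    by simp
  then have "lower_central G 1 = derived G (carrier G)"
    by (simp add: lower_central_def commutator_subgroup_def derived_def)
  also have "\<dots> = {\<one>\<^bsub>G\<^esub>}"
    by (rule derived_eq_singleton) simp
  finally show ?thesis
    unfolding nilpotent_group_def by blast
qed

lemma solvable_imp_nilpotent_series:
  assumes "solvable G"
  shows "\<exists>n. nilpotent_series G n (carrier G)"
proof -
  have "\<exists>n. nilpotent_series G n H" if "solvable_seq G H" for H
    using that
    by induction
      (blast intro: nilpotent_series.intros comm_group_imp_nilpotent_group)+
  with assms show ?thesis
    by (simp add: solvable_def)
qed

lemma fitting_length_trivial:
  assumes "carrier G = {\<one>\<^bsub>G\<^esub>}"
  shows "fitting_length G = 0"
  unfolding fitting_length_def using assms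
  by (metis Least_eq_0 nilpotent_series.unity)

end

theory Submission
  imports Defs
begin

text \<open>The normal structure of a finite soluble group is recorded by words of primes, written with the bottom
letter first. A group omits the word \<open>x\<^sub>1 \<dots> x\<^sub>n\<close> if it has a normal
series whose factors are, from the bottom, an \<open>x\<^sub>1'\<close>-group, an
\<open>x\<^sub>1\<close>-group, an \<open>x\<^sub>2'\<close>-group, an \<open>x\<^sub>2\<close>-group,
and so on up to an \<open>x\<^sub>n'\<close>-group. A word without equal neighbours that is not omitted
should be thought of as the trace of a tower of sections, one for each letter, in which every section
acts nontrivially on the one below.

Three facts connect words with the Fitting length.

\<^item> A nontrivial group \<open>G\<close> fails to omit some word of length \<open>h(G)\<close> without equal neighbours
  (\<open>critical_word\<close>). The Fitting subgroup is the intersection of the subgroups \<open>O\<^bsub>x'x\<^esub>(G)\<close>, hence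
  \<open>h(G / O\<^bsub>x'x\<^esub>(G)) = h(G) - 1\<close> for some prime \<open>x\<close>. This \<open>x\<close> becomes the bottom letter, and as
  \<open>G / O\<^bsub>x'x\<^esub>(G)\<close> has no nontrivial normal \<open>x\<close>-subgroup, the next letter can be chosen different from \<open>x\<close>.

\<^item> A group with a nilpotent series of length \<open>n\<close> omits all words of length greater than \<open>n\<close>
  (\<open>nilpotent_series_omits\<close>), because a nilpotent group is an extension of an \<open>x'\<close>-group by an \<open>x\<close>-group
  for every prime \<open>x\<close>.

\<^item> Let \<open>H\<close> be a subgroup of \<open>r\<close>-power index, for instance a Hall \<open>r'\<close>-subgroup, and let \<open>w\<^sub>r\<close> be the word
  obtained from \<open>w\<close> by deleting \<open>r\<close> and merging equal neighbours. If \<open>H\<close> omits \<open>w\<^sub>r\<close>, then \<open>G\<close> omits \<open>w\<close>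
  (\<open>omits_lift\<close>). This rests on the lemma of Hall and Higman that \<open>O\<^bsub>x'x\<^esub>(G) / O\<^bsub>x'\<^esub>(G)\<close> contains its
  centralizer (\<open>centralizer_mod_subset\<close>).

Together they give \<open>h(G\<^bsub>r'\<^esub>) \<ge> |w\<^sub>r|\<close> for a word \<open>w\<close>
of length \<open>h(G)\<close>. The rest is counting (\<open>two_letters\<close>). Deleting
\<open>r\<close> from \<open>w\<close> costs one for each occurrence of \<open>r\<close> and one for
each merger. A letter of \<open>w\<close> contributes at most two to the total cost over all primes, and
the last letter only one. So the total cost is at most \<open>2|w| - 1\<close>, and among four primes
there are two with total cost at most \<open>|w| - 1\<close>.

Hall \<open>p'\<close>-subgroups exist since an abelian normal \<open>p\<close>-subgroup of
\<open>p'\<close>-index has a complement (\<open>coprime_abelian_complement\<close>); the general case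
follows by induction along an abelian normal series.

All arguments take place inside one group: a section \<open>H/N\<close> is given by a subgroup
\<open>H\<close> and a subgroup \<open>N\<close> normal in it, and that \<open>H/N\<close> is an
\<open>x\<close>-group or an \<open>x'\<close>-group is expressed by saying that the powers of the
elements of \<open>H\<close> with exponent the \<open>x\<close>-part or the \<open>x'\<close>-part of
\<open>|G|\<close> lie in \<open>N\<close>.\<close>

section \<open>Relative normality and commutators\<close>

context group
begin

text \<open>The condition on elements agrees with normality in \<open>G\<lparr>carrier := H\<rparr>\<close>
(\<open>normal_in_iff_normal\<close>), but it refers to the operations of \<open>G\<close> only, so that
subgroups of different groups \<open>H\<close> can be mixed.\<close>

definition normal_in :: "'a set \<Rightarrow> 'a set \<Rightarrow> bool"
  where "normal_in N H \<longleftrightarrow> subgroup H G \<and> subgroup N G \<and> N \<subseteq> H \<and>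
    (\<forall>h\<in>H. \<forall>n\<in>N. h \<otimes> n \<otimes> inv h \<in> N)"

lemma normal_inI:
  assumes "subgroup H G" "subgroup N G" "N \<subseteq> H"
    and "\<And>h n. h \<in> H \<Longrightarrow> n \<in> N \<Longrightarrow> h \<otimes> n \<otimes> inv h \<in> N"
  shows "normal_in N H"
  using assms by (simp add: normal_in_def)

lemma normal_inD:
  assumes "normal_in N H"
  shows "subgroup H G" "subgroup N G" "N \<subseteq> H"
    "\<And>h n. h \<in> H \<Longrightarrow> n \<in> N \<Longrightarrow> h \<otimes> n \<otimes> inv h \<in> N"
  using assms by (simp_all add: normal_in_def)

lemma cancel_left [simp]:
  "x \<in> carrier G \<Longrightarrow> y \<in> carrier G \<Longrightarrow> inv x \<otimes> (x \<otimes> y) = y"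
  "x \<in> carrier G \<Longrightarrow> y \<in> carrier G \<Longrightarrow> x \<otimes> (inv x \<otimes> y) = y"
  by (simp_all flip: m_assoc)

lemma normal_in_iff_normal:
  assumes "subgroup H G"
  shows "normal_in N H \<longleftrightarrow> N \<lhd> (G\<lparr>carrier := H\<rparr>)"
proof -
  interpret H: group "G\<lparr>carrier := H\<rparr>"
    using assms by (rule subgroup_imp_group)
  have inv: "inv\<^bsub>G\<lparr>carrier := H\<rparr>\<^esub> x = inv x" if "x \<in> H" for x
    using assms that by (rule m_inv_consistent)
  show ?thesis
  proof
    assume n: "normal_in N H"
    show "N \<lhd> (G\<lparr>carrier := H\<rparr>)"
      using normal_inD[OF n] inv by (intro H.normal_invI subgroup_incl) auto
  next
    assume n: "N \<lhd> (G\<lparr>carrier := H\<rparr>)"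
    have 1: "subgroup N (G\<lparr>carrier := H\<rparr>)"
      using n by (rule normal_imp_subgroup)
    show "normal_in N H"
    proof (rule normal_inI[OF assms])
      show "subgroup N G"
        using assms 1 by (rule incl_subgroup)
      show "N \<subseteq> H"
        using subgroup.subset[OF 1] by simp
      show "h \<otimes> n \<otimes> inv h \<in> N" if "h \<in> H" "n \<in> N" for h n
        using H.normal_invE(2)[OF n, of h n] that inv by simp
    qed
  qed
qed

lemma normal_in_conj_inv:
  assumes "normal_in N H" "h \<in> H" "n \<in> N"
  shows "inv h \<otimes> n \<otimes> h \<in> N"
  using normal_inD(4)[OF assms(1), of "inv h" n] assms normal_inD[OF assms(1)]
  by (simp add: subgroup.m_inv_closed subgroup.mem_carrier)

lemma normal_in_refl: "subgroup H G \<Longrightarrow> normal_in H H"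
  by (auto intro!: normal_inI simp: subgroup.m_closed subgroup.m_inv_closed)

lemma normal_in_one: "subgroup H G \<Longrightarrow> normal_in {\<one>} H"
  by (auto intro!: normal_inI triv_subgroup simp: subgroup.one_closed subgroup.mem_carrier)

lemma normal_in_Int:
  assumes "normal_in N H" "normal_in M H"
  shows "normal_in (N \<inter> M) H"
  using assms subgroups_Inter_pair unfolding normal_in_def by auto

lemma normal_in_restrict:
  assumes "normal_in N H" "subgroup K G" "K \<subseteq> H"
  shows "normal_in (K \<inter> N) K"
  using assms subgroups_Inter_pair unfolding normal_in_def
  by (auto simp: subgroup.m_closed subgroup.m_inv_closed)

lemma normal_in_between:
  assumes "normal_in N H" "subgroup K G" "K \<subseteq> H" "N \<subseteq> K"
  shows "normal_in N K"
  using assms unfolding normal_in_def by blast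

lemma mem_set_mult: "x \<in> A <#> B \<longleftrightarrow> (\<exists>a\<in>A. \<exists>b\<in>B. x = a \<otimes> b)"
  by (auto simp: set_mult_def)

lemma set_mult_subgroup_normal_in:
  assumes "subgroup A G" "A \<subseteq> H" "normal_in N H"
  shows "subgroup (A <#> N) G" "A \<subseteq> A <#> N" "N \<subseteq> A <#> N" "A <#> N \<subseteq> H"
proof -
  note n = normal_inD[OF assms(3)]
  have c: "x \<in> carrier G" if "x \<in> H" for x
    using n(1) that by (rule subgroup.mem_carrier)
  show 1: "A \<subseteq> A <#> N"
    using subgroup.one_closed[OF n(2)] assms c by (force simp: mem_set_mult)
  show 2: "N \<subseteq> A <#> N"
    using subgroup.one_closed[OF assms(1)] n c by (force simp: mem_set_mult)
  show 3: "A <#> N \<subseteq> H"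
    using n assms by (auto simp: mem_set_mult subgroup.m_closed subset_iff)
  show "subgroup (A <#> N) G"
  proof (rule subgroupI)
    show "A <#> N \<subseteq> carrier G"
      using 3 c by blast
    show "A <#> N \<noteq> {}"
      using 2 subgroup.one_closed[OF n(2)] by blast
  next
    fix x assume "x \<in> A <#> N"
    then obtain a m where x: "a \<in> A" "m \<in> N" "x = a \<otimes> m"
      by (auto simp: mem_set_mult)
    have mem: "a \<in> H" "m \<in> H" "a \<in> carrier G" "m \<in> carrier G"
      using x assms n c by blast+
    have "inv x = inv a \<otimes> (a \<otimes> inv m \<otimes> inv a)"
      using mem x by (simp add: inv_mult_group m_assoc)
    moreover have "a \<otimes> inv m \<otimes> inv a \<in> N"
      using n mem x by (simp add: subgroup.m_inv_closed)
    ultimately show "inv x \<in> A <#> N"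
      using x assms by (auto simp: mem_set_mult subgroup.m_inv_closed)
  next
    fix x y assume "x \<in> A <#> N" "y \<in> A <#> N"
    then obtain a m b k where x: "a \<in> A" "m \<in> N" "x = a \<otimes> m" "b \<in> A" "k \<in> N" "y = b \<otimes> k"
      by (auto simp: mem_set_mult)
    have mem: "a \<in> H" "m \<in> H" "a \<in> carrier G" "m \<in> carrier G"
        "b \<in> H" "k \<in> H" "b \<in> carrier G" "k \<in> carrier G"
      using x assms n c by blast+
    have "x \<otimes> y = (a \<otimes> b) \<otimes> ((inv b \<otimes> m \<otimes> b) \<otimes> k)"
      using mem x by (simp add: inv_mult_group m_assoc)
    moreover have "(inv b \<otimes> m \<otimes> b) \<otimes> k \<in> N"
      using n mem x normal_in_conj_inv[OF assms(3)] by (simp add: subgroup.m_closed)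
    moreover have "a \<otimes> b \<in> A"
      using x assms by (simp add: subgroup.m_closed)
    ultimately show "x \<otimes> y \<in> A <#> N"
      by (auto simp: mem_set_mult)
  qed
qed

lemma normal_in_set_mult:
  assumes "normal_in A H" "normal_in N H"
  shows "normal_in (A <#> N) H"
proof -
  note a = normal_inD[OF assms(1)] and n = normal_inD[OF assms(2)]
  show ?thesis
  proof (rule normal_inI)
    fix h x assume h: "h \<in> H" and "x \<in> A <#> N"
    then obtain b m where x: "b \<in> A" "m \<in> N" "x = b \<otimes> m"
      by (auto simp: mem_set_mult)
    have mem: "h \<in> carrier G" "b \<in> carrier G" "m \<in> carrier G"
      using h x a n by (auto simp: subgroup.mem_carrier)
    have "h \<otimes> x \<otimes> inv h = (h \<otimes> b \<otimes> inv h) \<otimes> (h \<otimes> m \<otimes> inv h)"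
      using mem x by (simp add: m_assoc)
    then show "h \<otimes> x \<otimes> inv h \<in> A <#> N"
      unfolding mem_set_mult using a(4)[OF h x(1)] n(4)[OF h x(2)] by blast
  qed (use set_mult_subgroup_normal_in[OF a(2,3) assms(2)] a in auto)
qed

lemma subgroup_pow_closed:
  assumes "subgroup N G" "n \<in> N"
  shows "n [^] (k::nat) \<in> N"
  by (induction k) (use assms in \<open>auto simp: subgroup.one_closed subgroup.m_closed\<close>)

text \<open>Powers of congruent elements are congruent modulo a normal subgroup.\<close>

lemma pow_mult_normal_in:
  assumes "normal_in N H" "a \<in> H" "n \<in> N"
  shows "\<exists>n'\<in>N. (n \<otimes> a) [^] (k::nat) = n' \<otimes> a [^] k"
proof (induction k)
  case 0
  show ?case
    using subgroup.one_closed[OF normal_inD(2)[OF assms(1)]] by force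
next
  case (Suc k)
  note n = normal_inD[OF assms(1)]
  obtain m where m: "m \<in> N" "(n \<otimes> a) [^] k = m \<otimes> a [^] k"
    using Suc by blast
  have mem: "a \<in> carrier G" "n \<in> carrier G" "m \<in> carrier G"
    using assms m n by (auto simp: subgroup.mem_carrier)
  have ak: "a [^] k \<in> H"
    using n(1) assms(2) by (rule subgroup_pow_closed)
  have "(n \<otimes> a) [^] Suc k = (m \<otimes> (a [^] k \<otimes> n \<otimes> inv (a [^] k))) \<otimes> a [^] Suc k"
    using mem m by (simp add: m_assoc)
  moreover have "m \<otimes> (a [^] k \<otimes> n \<otimes> inv (a [^] k)) \<in> N"
    using n ak m assms by (simp add: subgroup.m_closed)
  ultimately show ?case
    by blast
qed

lemma pow_mem_mult_normal_in:
  assumes "normal_in N H" "a \<in> H" "n \<in> N"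
  shows "(n \<otimes> a) [^] (k::nat) \<in> N \<longleftrightarrow> a [^] k \<in> N"
    and "(a \<otimes> n) [^] (k::nat) \<in> N \<longleftrightarrow> a [^] k \<in> N"
proof -
  note n = normal_inD[OF assms(1)]
  have *: "(n \<otimes> a) [^] (k::nat) \<in> N \<longleftrightarrow> a [^] k \<in> N" if "n \<in> N" for n
  proof -
    obtain n' where n': "n' \<in> N" "(n \<otimes> a) [^] k = n' \<otimes> a [^] k"
      using pow_mult_normal_in[OF assms(1,2) \<open>n \<in> N\<close>] by blast
    have mem: "a \<in> carrier G" "n' \<in> carrier G"
      using assms n' n by (auto simp: subgroup.mem_carrier)
    have "a [^] k = inv n' \<otimes> (n' \<otimes> a [^] k)"
      using mem by simp
    then show ?thesis
      using n' n by (metis subgroup.m_closed subgroup.m_inv_closed)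
  qed
  show "(n \<otimes> a) [^] (k::nat) \<in> N \<longleftrightarrow> a [^] k \<in> N"
    using * assms by simp
  have mem: "a \<in> carrier G" "n \<in> carrier G"
    using assms n by (auto simp: subgroup.mem_carrier)
  have "a \<otimes> n = (a \<otimes> n \<otimes> inv a) \<otimes> a"
    using mem by (simp add: m_assoc)
  then show "(a \<otimes> n) [^] (k::nat) \<in> N \<longleftrightarrow> a [^] k \<in> N"
    using *[of "a \<otimes> n \<otimes> inv a"] n(4) assms by simp
qed

definition comm :: "'a \<Rightarrow> 'a \<Rightarrow> 'a"
  where "comm g y = g \<otimes> y \<otimes> inv g \<otimes> inv y"

text \<open>Modulo \<open>L\<close> the commutator \<open>c\<close> of \<open>g\<close> and \<open>y\<close> is
fixed under conjugation by \<open>g\<close>. As \<open>g y g\<^sup>-\<^sup>1 = c y\<close>, each further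
conjugation by \<open>g\<close> multiplies by another \<open>c\<close>.\<close>

lemma comm_pow_normal_in:
  assumes "normal_in L H" "g \<in> H" "y \<in> H" "comm g (comm g y) \<in> L"
  shows "\<exists>l\<in>L. comm (g [^] (k::nat)) y = l \<otimes> comm g y [^] k"
proof (induction k)
  note n = normal_inD[OF assms(1)]
  case 0
  have "y \<in> carrier G"
    using assms n by (auto simp: subgroup.mem_carrier)
  then show ?case
    using subgroup.one_closed[OF n(2)] by (force simp: comm_def)
next
  case (Suc k)
  note n = normal_inD[OF assms(1)]
  define c where "c = comm g y"
  have mem: "g \<in> carrier G" "y \<in> carrier G"
    using assms n by (auto simp: subgroup.mem_carrier)
  have cH: "c \<in> H"
    unfolding c_def comm_def using n(1) assms
    by (simp add: subgroup.m_closed subgroup.m_inv_closed)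
  have c: "c \<in> carrier G"
    using cH n(1) by (simp add: subgroup.mem_carrier)
  obtain l where l: "l \<in> L" "comm (g [^] k) y = l \<otimes> c [^] k"
    using Suc c_def by blast
  have lc: "l \<in> carrier G"
    using l n(2) by (auto simp: subgroup.mem_carrier)
  define d where "d = comm g c"
  have d: "d \<in> L"
    using assms unfolding d_def c_def by simp
  have dc: "d \<in> carrier G"
    using d n(2) by (auto simp: subgroup.mem_carrier)
  have conj_c: "g \<otimes> c \<otimes> inv g = d \<otimes> c"
    unfolding d_def comm_def using mem c by (simp add: m_assoc)
  have "g \<otimes> c [^] j \<otimes> inv g = (g \<otimes> c \<otimes> inv g) [^] j" for j :: nat
  proof (induction j)
    case (Suc j)
    have "g \<otimes> c [^] Suc j \<otimes> inv g = (g \<otimes> c [^] j \<otimes> inv g) \<otimes> (g \<otimes> c \<otimes> inv g)"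
      using mem c by (simp add: m_assoc)
    then show ?case
      using Suc by simp
  qed (use mem in simp)
  then obtain m where m: "m \<in> L" "g \<otimes> c [^] k \<otimes> inv g = m \<otimes> c [^] k"
    using pow_mult_normal_in[OF assms(1) cH d, of k] conj_c by metis
  have mc: "m \<in> carrier G"
    using m n(2) by (auto simp: subgroup.mem_carrier)
  have gS: "g [^] Suc k = g \<otimes> g [^] k"
    using mem(1) by (rule nat_pow_Suc2)
  have "comm (g [^] Suc k) y = g \<otimes> comm (g [^] k) y \<otimes> inv g \<otimes> c"
    unfolding gS unfolding comm_def c_def using mem by (simp add: m_assoc inv_mult_group)
  also have "\<dots> = (g \<otimes> l \<otimes> inv g) \<otimes> (g \<otimes> c [^] k \<otimes> inv g) \<otimes> c"
    using l lc c mem by (simp add: m_assoc)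
  also have "\<dots> = ((g \<otimes> l \<otimes> inv g) \<otimes> m) \<otimes> c [^] Suc k"
    unfolding m using mc lc c mem by (simp add: m_assoc)
  finally show ?case
    using n(4)[OF assms(2) l(1)] m(1) subgroup.m_closed[OF n(2)] unfolding c_def by blast
qed

lemma comm_in_left:
  assumes "normal_in N H" "n \<in> N" "y \<in> H"
  shows "comm n y \<in> N"
proof -
  note n = normal_inD[OF assms(1)]
  have mem: "n \<in> carrier G" "y \<in> carrier G"
    using assms n by (auto simp: subgroup.mem_carrier)
  have "comm n y = n \<otimes> (y \<otimes> inv n \<otimes> inv y)"
    using mem by (simp add: comm_def m_assoc)
  then show ?thesis
    using n assms by (simp add: subgroup.m_closed subgroup.m_inv_closed)
qed

lemma inv_comm:
  assumes "g \<in> carrier G" "y \<in> carrier G"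
  shows "inv (comm g y) = comm y g"
  using assms by (simp add: comm_def m_assoc inv_mult_group)

lemma comm_in_right:
  assumes "normal_in N H" "n \<in> N" "y \<in> H"
  shows "comm y n \<in> N"
proof -
  note n = normal_inD[OF assms(1)]
  have mem: "n \<in> carrier G" "y \<in> carrier G"
    using assms n by (auto simp: subgroup.mem_carrier)
  show ?thesis
    using comm_in_left[OF assms] inv_comm[OF mem] subgroup.m_inv_closed[OF n(2)] by metis
qed

lemma comm_mult_left:
  assumes "a \<in> carrier G" "b \<in> carrier G" "y \<in> carrier G"
  shows "comm (a \<otimes> b) y = (a \<otimes> comm b y \<otimes> inv a) \<otimes> comm a y"
  using assms by (simp add: comm_def m_assoc inv_mult_group)

lemma comm_inv_left:
  assumes "a \<in> carrier G" "y \<in> carrier G"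
  shows "comm (inv a) y = inv a \<otimes> inv (comm a y) \<otimes> inv (inv a)"
  using assms by (simp add: comm_def m_assoc inv_mult_group)

lemma conj_comm:
  assumes "a \<in> carrier G" "b \<in> carrier G" "h \<in> carrier G"
  shows "h \<otimes> comm a b \<otimes> inv h = comm (h \<otimes> a \<otimes> inv h) (h \<otimes> b \<otimes> inv h)"
  using assms by (simp add: comm_def m_assoc inv_mult_group)

text \<open>The elements of \<open>H\<close> that act trivially on \<open>M\<close> modulo \<open>K\<close>. For
\<open>M = H\<close> this is the preimage of the center of \<open>H/K\<close>.\<close>

definition centralizer_mod :: "'a set \<Rightarrow> 'a set \<Rightarrow> 'a set \<Rightarrow> 'a set"
  where "centralizer_mod H M K = {g \<in> H. \<forall>y\<in>M. comm g y \<in> K}"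

text \<open>Closure under the group operations comes from the identities that express the commutators
of a product, an inverse and a conjugate through conjugates of commutators.\<close>

lemma normal_in_centralizer_mod:
  assumes "normal_in K H" "normal_in M H"
  shows "normal_in (centralizer_mod H M K) H"
proof -
  note k = normal_inD[OF assms(1)] and m = normal_inD[OF assms(2)]
  have hc: "x \<in> carrier G" if "x \<in> H" for x
    using k(1) that by (rule subgroup.mem_carrier)
  have mH: "y \<in> H" if "y \<in> M" for y
    using m that by blast
  show ?thesis
  proof (rule normal_inI)
    show "subgroup (centralizer_mod H M K) G"
    proof (rule subgroupI)
      show "centralizer_mod H M K \<subseteq> carrier G"
        using hc by (auto simp: centralizer_mod_def)
      show "centralizer_mod H M K \<noteq> {}"
      proof -
        have "comm \<one> y \<in> K" if "y \<in> M" for y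
          using hc[OF mH[OF that]] subgroup.one_closed[OF k(2)] by (simp add: comm_def)
        then have "\<one> \<in> centralizer_mod H M K"
          using subgroup.one_closed[OF k(1)] by (simp add: centralizer_mod_def)
        then show ?thesis
          by blast
      qed
    next
      fix a assume a: "a \<in> centralizer_mod H M K"
      have "comm (inv a) y \<in> K" if y: "y \<in> M" for y
      proof -
        have "a \<in> H" "inv a \<in> H" "comm a y \<in> K" "a \<in> carrier G" "y \<in> carrier G"
          using a y hc mH k(1) by (auto simp: centralizer_mod_def subgroup.m_inv_closed)
        then show ?thesis
          using k(4)[of "inv a" "inv comm a y"] subgroup.m_inv_closed[OF k(2)]
          by (simp add: comm_inv_left)
      qed
      then show "inv a \<in> centralizer_mod H M K"
        using a k(1) by (simp add: centralizer_mod_def subgroup.m_inv_closed)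
    next
      fix a b assume ab: "a \<in> centralizer_mod H M K" "b \<in> centralizer_mod H M K"
      then have "comm (a \<otimes> b) y \<in> K" if "y \<in> M" for y
        using that hc mH k(4) subgroup.m_closed[OF k(2)]
        by (simp add: centralizer_mod_def comm_mult_left)
      then show "a \<otimes> b \<in> centralizer_mod H M K"
        using ab k(1) by (simp add: centralizer_mod_def subgroup.m_closed)
    qed
    fix h n assume h: "h \<in> H" and n: "n \<in> centralizer_mod H M K"
    have "comm (h \<otimes> n \<otimes> inv h) y \<in> K" if y: "y \<in> M" for y
    proof -
      have mem: "h \<in> carrier G" "n \<in> carrier G" "y \<in> carrier G" "n \<in> H"
        using h n y hc mH by (auto simp: centralizer_mod_def)
      have "y = h \<otimes> (inv h \<otimes> y \<otimes> h) \<otimes> inv h"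
        using mem by (simp add: m_assoc)
      then have "comm (h \<otimes> n \<otimes> inv h) y = h \<otimes> comm n (inv h \<otimes> y \<otimes> h) \<otimes> inv h"
        using mem conj_comm[of n "inv h \<otimes> y \<otimes> h" h] by simp
      moreover have "inv h \<otimes> y \<otimes> h \<in> M"
        using normal_in_conj_inv[OF assms(2) h y] .
      ultimately show ?thesis
        using n k(4) h by (simp add: centralizer_mod_def)
    qed
    then show "h \<otimes> n \<otimes> inv h \<in> centralizer_mod H M K"
      using h n k(1) 
      by (simp add: centralizer_mod_def subgroup.m_closed subgroup.m_inv_closed)
  qed (auto simp: centralizer_mod_def k)
qed

end

section \<open>Sections of prime power order\<close>

text \<open>Sylow's theorem yields a subgroup of order \<open>x\<close>; each of its nontrivial elements has order
\<open>x\<close>, which therefore divides every exponent of the group.\<close>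

lemma cauchy_exponent:
  fixes Q (structure)
  assumes "group Q" "finite (carrier Q)" "Factorial_Ring.prime x" "x dvd order Q"
    and "\<And>g. g \<in> carrier Q \<Longrightarrow> g [^] (k::nat) = \<one>"
  shows "x dvd k"
proof -
  interpret group Q by fact
  obtain m where "order Q = x ^ 1 * m"
    using assms(4) by auto
  then obtain S where S: "subgroup S Q" "card S = x ^ 1"
    using sylow_thm[OF assms(3,1) _ assms(2)] by blast
  interpret S: group "Q\<lparr>carrier := S\<rparr>"
    using S(1) by (rule subgroup_imp_group)
  have "\<not> S \<subseteq> {\<one>}"
    using S(2) assms(3) card_mono[of "{\<one>}" S] prime_gt_1_nat[of x] by auto
  then obtain g where g: "g \<in> S" "g \<noteq> \<one>"
    by blast
  have gc: "g \<in> carrier Q"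
    using S(1) g(1) by (rule subgroup.mem_carrier)
  have "g [^] x = \<one>"
    using S.pow_order_eq_1[of g] g S by (simp add: order_def flip: nat_pow_consistent)
  then have "ord g dvd x"
    using gc pow_eq_id by blast
  moreover have "ord g \<noteq> 1"
    using gc g(2) ord_eq_1 by simp
  ultimately have "ord g = x"
    using assms(3) prime_nat_iff by blast
  then show ?thesis
    using assms(5)[OF gc] gc pow_eq_id by blast
qed

text \<open>The class equation: a conjugacy class is a singleton precisely if its element is central, and otherwise
its size is divisible by \<open>x\<close>. The class of the unit is a singleton, and as \<open>x\<close>
divides the group order it cannot be the only one.\<close>

lemma p_group_center:
  fixes Q (structure)
  assumes "group Q" "finite (carrier Q)" "Factorial_Ring.prime x" "order Q = x ^ Suc a"
  shows "\<exists>z\<in>carrier Q. z \<noteq> \<one> \<and> (\<forall>y\<in>carrier Q. z \<otimes> y = y \<otimes> z)"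
proof (rule ccontr)
  assume no: "\<not> ?thesis"
  interpret group Q by fact
  define \<phi> where "\<phi> = (\<lambda>g. \<lambda>h \<in> carrier Q. g \<otimes> h \<otimes> inv g)"
  interpret act: group_action Q "carrier Q" \<phi>
    unfolding \<phi>_def by (rule action_by_conjugation)
  have \<phi>: "\<phi> g h = g \<otimes> h \<otimes> inv g" if "h \<in> carrier Q" for g h
    using that by (simp add: \<phi>_def)
  have orb_one: "orbit Q \<phi> \<one> = {\<one>}"
    by (force simp: orbit_def \<phi>)
  have orb: "x dvd card (orbit Q \<phi> z)" if z: "z \<in> carrier Q" "z \<noteq> \<one>" for z
  proof -
    have fin: "finite (orbit Q \<phi> z)"
      using assms(2) by (simp add: orbit_def)
    obtain y where y: "y \<in> carrier Q" "z \<otimes> y \<noteq> y \<otimes> z"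
      using no z by blast
    have "y \<otimes> z \<otimes> inv y \<noteq> z"
    proof
      assume "y \<otimes> z \<otimes> inv y = z"
      then have "y \<otimes> z \<otimes> inv y \<otimes> y = z \<otimes> y"
        by simp
      then show False
        using y z by (simp add: m_assoc)
    qed
    moreover have "y \<otimes> z \<otimes> inv y \<in> orbit Q \<phi> z" "z \<in> orbit Q \<phi> z"
      using y z act.orbit_refl \<phi> by (auto simp: orbit_def)
    ultimately have "card (orbit Q \<phi> z) \<noteq> 1"
      by (metis card_1_singletonE singletonD)
    moreover have "card (orbit Q \<phi> z) dvd x ^ Suc a"
      using act.orbit_stabilizer_theorem[OF z(1)] assms(4) by (metis dvd_triv_left)
    ultimately show ?thesis
      using assms(3) by (metis divides_primepow_nat dvd_power power_0 gr0I)
  qed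
  have "order Q = card (\<Union> (orbits Q (carrier Q) \<phi>))"
    unfolding act.orbits_coverture order_def ..
  also have "\<dots> = (\<Sum>c\<in>orbits Q (carrier Q) \<phi>. card c)"
    using assms(2) act.disjoint_union
    by (intro card_Union_disjoint) (auto simp: pairwise_def disjnt_def orbits_def orbit_def)
  also have "\<dots> = card {\<one>} + (\<Sum>c\<in>orbits Q (carrier Q) \<phi> - {{\<one>}}. card c)"
  proof (rule sum.remove)
    show "finite (orbits Q (carrier Q) \<phi>)"
      using assms(2) by (simp add: orbits_def)
    show "{\<one>} \<in> orbits Q (carrier Q) \<phi>"
      using orb_one by (auto simp: orbits_def)
  qed
  finally have eq: "x ^ Suc a = 1 + (\<Sum>c\<in>orbits Q (carrier Q) \<phi> - {{\<one>}}. card c)"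
    using assms(4) by simp
  have "x dvd (\<Sum>c\<in>orbits Q (carrier Q) \<phi> - {{\<one>}}. card c)"
  proof (rule dvd_sum)
    fix c assume "c \<in> orbits Q (carrier Q) \<phi> - {{\<one>}}"
    then show "x dvd card c"
      using orb orb_one by (auto simp: orbits_def)
  qed
  moreover have "x dvd x ^ Suc a"
    by simp
  ultimately have "x dvd 1"
    unfolding eq using dvd_add_left_iff by blast
  then show False
    using assms(3) not_prime_unit by blast
qed

context group
begin

text \<open>A dictionary between the quotient \<open>H/N\<close> and the elements of \<open>H\<close>; it is used
wherever an argument takes place in a genuine quotient group.\<close>

lemma section_quotient:
  assumes "normal_in N H"
  defines "Q \<equiv> G\<lparr>carrier := H\<rparr> Mod N"
  shows "group Q" "carrier Q = (\<lambda>h. N #> h) ` H"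
    "\<And>h h'. h \<in> H \<Longrightarrow> h' \<in> H \<Longrightarrow> (N #> h) \<otimes>\<^bsub>Q\<^esub> (N #> h') = N #> (h \<otimes> h')"
    "\<And>h. h \<in> H \<Longrightarrow> inv\<^bsub>Q\<^esub> (N #> h) = N #> inv h"
    "\<And>h k. h \<in> H \<Longrightarrow> (N #> h) [^]\<^bsub>Q\<^esub> (k::nat) = N #> (h [^] k)"
    "\<one>\<^bsub>Q\<^esub> = N"
    "\<And>h. h \<in> H \<Longrightarrow> N #> h = N \<longleftrightarrow> h \<in> N"
    "order Q * card N = card H"
proof -
  note n = normal_inD[OF assms(1)]
  interpret H: group "G\<lparr>carrier := H\<rparr>"
    using n(1) by (rule subgroup_imp_group)
  have norm: "N \<lhd> (G\<lparr>carrier := H\<rparr>)"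
    using assms(1) normal_in_iff_normal[OF n(1)] by blast
  then interpret N: normal N "G\<lparr>carrier := H\<rparr>" .
  show "group Q"
    unfolding Q_def by (rule N.factorgroup_is_group)
  then interpret Q: group Q .
  show carr: "carrier Q = (\<lambda>h. N #> h) ` H"
    unfolding Q_def carrier_FactGroup by simp
  show one: "\<one>\<^bsub>Q\<^esub> = N"
    by (simp add: Q_def)
  show mult: "(N #> h) \<otimes>\<^bsub>Q\<^esub> (N #> h') = N #> (h \<otimes> h')" if "h \<in> H" "h' \<in> H" for h h'
    using N.rcos_sum[of h h'] that by (simp add: Q_def)
  show mem: "N #> h = N \<longleftrightarrow> h \<in> N" if "h \<in> H" for h
    using that n coset_join1 coset_join2 subgroup.mem_carrier subgroup.subset by metis
  show "inv\<^bsub>Q\<^esub> (N #> h) = N #> inv h" if h: "h \<in> H" for h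
  proof (rule Q.inv_equality)
    have "inv h \<in> H" "h \<in> carrier G"
      using h n(1) by (auto simp: subgroup.m_inv_closed subgroup.mem_carrier)
    then show "(N #> inv h) \<otimes>\<^bsub>Q\<^esub> (N #> h) = \<one>\<^bsub>Q\<^esub>" "N #> inv h \<in> carrier Q"
      using h mult[of "inv h" h] one mem[OF subgroup.one_closed[OF n(1)]] carr
        subgroup.one_closed[OF n(2)] by simp_all
    show "N #> h \<in> carrier Q"
      using h carr by simp
  qed
  show "(N #> h) [^]\<^bsub>Q\<^esub> (k::nat) = N #> (h [^] k)" if "h \<in> H" for h k
    using N.FactGroup_pow[of h k] that unfolding Q_def by (simp flip: nat_pow_consistent)
  show "order Q * card N = card H"
    using H.lagrange[OF N.subgroup_axioms] by (simp add: order_def Q_def FactGroup_def)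
qed

lemma comm_mem_iff_section:
  assumes "normal_in N H" "h \<in> H" "y \<in> H"
  shows "comm h y \<in> N \<longleftrightarrow> N #> (h \<otimes> y) = N #> (y \<otimes> h)"
proof -
  note n = normal_inD[OF assms(1)]
  have mem: "h \<otimes> y \<in> carrier G" "y \<otimes> h \<in> carrier G" "h \<in> carrier G" "y \<in> carrier G"
    using assms n by (auto simp: subgroup.mem_carrier)
  have "comm h y = (h \<otimes> y) \<otimes> inv (y \<otimes> h)"
    using mem by (simp add: comm_def m_assoc inv_mult_group)
  then have "comm h y \<in> N \<longleftrightarrow> h \<otimes> y \<in> N #> (y \<otimes> h)"
    using mem subgroup.rcos_module[OF n(2) is_group] by simp
  also have "\<dots> \<longleftrightarrow> N #> (h \<otimes> y) = N #> (y \<otimes> h)"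
    using mem repr_independence[OF _ _ n(2)] rcos_self[OF _ n(2)] by metis
  finally show ?thesis .
qed

end

locale fin_group = group +
  assumes finite_carrier: "finite (carrier G)"

context fin_group
begin

lemma finite_subgroup: "subgroup H G \<Longrightarrow> finite H"
  using finite_carrier finite_subset subgroup.subset by blast

lemma card_subgroup_pos: "subgroup H G \<Longrightarrow> card H > 0"
  using finite_subgroup subgroup.one_closed by (metis card_gt_0_iff empty_iff)

lemma order_pos: "order G > 0"
  using finite_carrier order_gt_0_iff_finite by blast

lemma card_subgroup_dvd: 
  assumes "subgroup K G" "subgroup H G" "K \<subseteq> H"
  shows "card K dvd card H"
proof -
  interpret H: group "G\<lparr>carrier := H\<rparr>"
    using assms(2) by (rule subgroup_imp_group)
  have "subgroup K (G\<lparr>carrier := H\<rparr>)"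
    using assms subgroup_incl by blast
  then show ?thesis
    using H.lagrange[of K] unfolding order_def by (simp, metis dvd_triv_right)
qed

lemma card_subgroup_dvd_order: "subgroup H G \<Longrightarrow> card H dvd order G"
  using card_subgroup_dvd[OF _ subgroup_self] subgroup.subset unfolding order_def by blast

lemma subgroup_eqI:
  assumes "subgroup K G" "subgroup H G" "K \<subseteq> H" "card H dvd card K"
  shows "K = H"
proof (rule card_seteq)
  show "card H \<le> card K"
    using assms(4) card_subgroup_pos[OF assms(1)] by (rule dvd_imp_le)
qed (use assms finite_subgroup in auto)

definition powers_in :: "nat \<Rightarrow> 'a set \<Rightarrow> 'a set \<Rightarrow> bool"
  where "powers_in k A N \<longleftrightarrow> (\<forall>a\<in>A. a [^] k \<in> N)"

text \<open>Lagrange's theorem in the quotient \<open>H/N\<close>.\<close>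

lemma powers_in_index:
  assumes "normal_in N H"
  shows "powers_in (card H div card N) H N"
proof -
  note n = normal_inD[OF assms] and q = section_quotient[OF assms]
  have "card H div card N = order (G\<lparr>carrier := H\<rparr> Mod N)"
    using q(8) card_subgroup_pos[OF n(2)] by (metis nonzero_mult_div_cancel_right less_numeral_extra(3))
  then have "N #> (h [^] (card H div card N)) = N" if "h \<in> H" for h
    using that group.pow_order_eq_1[OF q(1), of "N #> h"] by (simp add: q)
  then show ?thesis
    using q(7) n(1) subgroup_pow_closed unfolding powers_in_def by blast
qed

lemma prime_dvd_exponent:
  assumes "normal_in N H" "powers_in k H N" "Factorial_Ring.prime x" "x dvd card H div card N"
  shows "x dvd k"
proof -
  note n = normal_inD[OF assms(1)] and q = section_quotient[OF assms(1)]
  have "card H div card N = order (G\<lparr>carrier := H\<rparr> Mod N)"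
    using q(8) card_subgroup_pos[OF n(2)] by (metis nonzero_mult_div_cancel_right less_numeral_extra(3))
  moreover have "finite (carrier (G\<lparr>carrier := H\<rparr> Mod N))"
    using finite_subgroup[OF n(1)] by (simp add: q(2))
  moreover have "g [^]\<^bsub>G\<lparr>carrier := H\<rparr> Mod N\<^esub> k = \<one>\<^bsub>G\<lparr>carrier := H\<rparr> Mod N\<^esub>"
    if "g \<in> carrier (G\<lparr>carrier := H\<rparr> Mod N)" for g
  proof -
    obtain h where h: "h \<in> H" "g = N #> h"
      using \<open>g \<in> _\<close> unfolding q(2) by blast
    then show ?thesis
      using assms(2) q(5,6,7) n subgroup_pow_closed unfolding powers_in_def by metis
  qed
  ultimately show ?thesis
    using cauchy_exponent[OF q(1)] assms(3,4) by metis
qed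

lemma index_prime_power:
  assumes "normal_in N H" "powers_in (x ^ a) H N" "Factorial_Ring.prime x"
  obtains b where "card H = card N * x ^ b"
proof -
  note n = normal_inD[OF assms(1)]
  define m where "m = card H div card N"
  have m: "card H = card N * m"
    using card_subgroup_dvd[OF n(2,1,3)] by (simp add: m_def)
  have "m \<noteq> 0"
    using m card_subgroup_pos[OF n(1)] by auto
  moreover have "y = x" if "Factorial_Ring.prime y" "y dvd m" for y
    using prime_dvd_exponent[OF assms(1,2) that(1)] that assms(3)
      prime_dvd_power primes_dvd_imp_eq unfolding m_def by blast
  moreover obtain q where q: "m = x ^ multiplicity x m * q" "\<not> x dvd q"
    using multiplicity_decompose'[of m x] \<open>m \<noteq> 0\<close> assms(3) not_prime_unit by metis
  ultimately have "q = 1"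
    by (metis dvd_triv_right dvd_trans prime_factor_nat)
  then show thesis
    using m that q(1) by (metis mult.right_neutral)
qed

lemma p_section_center:
  assumes "normal_in N H" "powers_in (x ^ a) H N" "Factorial_Ring.prime x" "N \<noteq> H"
  shows "\<exists>h\<in>H. h \<notin> N \<and> (\<forall>y\<in>H. comm h y \<in> N)"
proof -
  note n = normal_inD[OF assms(1)] and q = section_quotient[OF assms(1)]
  let ?Q = "G\<lparr>carrier := H\<rparr> Mod N"
  obtain b where b: "card H = card N * x ^ b"
    using index_prime_power[OF assms(1-3)] .
  have "b \<noteq> 0"
    using b assms(4) subgroup_eqI[OF n(2,1,3)] by auto
  then obtain c where "b = Suc c"
    using not0_implies_Suc by blast
  then have "order ?Q = x ^ Suc c"
    using b q(8) card_subgroup_pos[OF n(2)] by (simp add: mult.commute)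
  then obtain z where z: "z \<in> carrier ?Q" "z \<noteq> \<one>\<^bsub>?Q\<^esub>"
      "\<And>y. y \<in> carrier ?Q \<Longrightarrow> z \<otimes>\<^bsub>?Q\<^esub> y = y \<otimes>\<^bsub>?Q\<^esub> z"
    using p_group_center[OF q(1) _ assms(3)] finite_subgroup[OF n(1)] q(2) by (metis finite_imageI)
  obtain h where h: "h \<in> H" "z = N #> h"
    using z(1) q(2) by auto
  have "comm h y \<in> N" if "y \<in> H" for y
    using z(3)[of "N #> y"] q h that comm_mem_iff_section[OF assms(1) h(1) that] by auto
  then show ?thesis
    using h z(2) q by auto
qed

lemma pow_gcd_mem:
  assumes "subgroup N G" "g \<in> carrier G" "g [^] (k::nat) \<in> N" "g [^] (l::nat) \<in> N"
  shows "g [^] gcd k l \<in> N"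
proof (cases "k = 0")
  case False
  then obtain x y where xy: "k * x = l * y + gcd k l"
    using bezout_nat by blast
  have 1: "g [^] (k * x) \<in> N" "g [^] (l * y) \<in> N"
    using subgroup_pow_closed[OF assms(1,3), of x] subgroup_pow_closed[OF assms(1,4), of y]
      assms(2) by (simp_all add: nat_pow_pow)
  have "g [^] (k * x) = g [^] (l * y) \<otimes> g [^] gcd k l"
    unfolding xy using assms(2) by (simp add: nat_pow_mult)
  then have "g [^] gcd k l = inv (g [^] (l * y)) \<otimes> g [^] (k * x)"
    using assms(2) by simp
  then show ?thesis
    using 1 assms(1) by (simp add: subgroup.m_closed subgroup.m_inv_closed)
qed (use assms in simp)

lemma pow_gcd_order_mem:
  assumes "subgroup N G" "g \<in> carrier G" "g [^] (k::nat) \<in> N"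
  shows "g [^] gcd k (order G) \<in> N"
  using pow_gcd_mem[OF assms] pow_order_eq_1[OF assms(2)] subgroup.one_closed[OF assms(1)] by simp

lemma coprime_pow_mem:
  assumes "subgroup N G" "g \<in> carrier G" "g [^] (k::nat) \<in> N" "g [^] (l::nat) \<in> N" "coprime k l"
  shows "g \<in> N"
  using pow_gcd_mem[OF assms(1-4)] assms(2,5) by simp

section \<open>Exponents and radicals\<close>

text \<open>The unitary divisors of \<open>|G|\<close>, those coprime to the complementary divisor. For such
\<open>k\<close> the sections of exponent dividing \<open>k\<close> are closed under extensions
(\<open>powers_in_trans\<close>): an extension has exponent dividing \<open>k\<^sup>2\<close>, and
elements of \<open>G\<close> killed by \<open>k\<^sup>2\<close> are killed by \<open>k\<close>. Both the
\<open>x\<close>-part and the \<open>x'\<close>-part of \<open>|G|\<close> are unitary.\<close>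

definition unitary :: "nat \<Rightarrow> bool"
  where "unitary k \<longleftrightarrow> gcd (k * k) (order G) = k"

definition ppart :: "nat \<Rightarrow> nat"
  where "ppart x = x ^ multiplicity x (order G)"

definition pcopart :: "nat \<Rightarrow> nat"
  where "pcopart x = order G div ppart x"

lemma ppart_pcopart: "ppart x * pcopart x = order G"
  unfolding ppart_def pcopart_def by (simp add: multiplicity_dvd)

lemma not_dvd_pcopart:
  assumes "Factorial_Ring.prime x"
  shows "\<not> x dvd pcopart x"
  unfolding pcopart_def ppart_def
  using multiplicity_decompose[of "order G" x] order_pos assms not_prime_unit by blast

lemma coprime_ppart_pcopart:
  assumes "Factorial_Ring.prime x"
  shows "coprime (ppart x) (pcopart x)"
  using not_dvd_pcopart[OF assms] assms unfolding ppart_def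
  by (simp add: prime_imp_coprime coprime_power_left_iff)

lemma unitaryI:
  assumes "k * l = order G" "coprime k l"
  shows "unitary k"
proof -
  have "gcd (k * k) (order G) = k * gcd k l"
    unfolding assms(1)[symmetric] by (simp add: gcd_mult_distrib_nat)
  then show ?thesis
    using assms(2) by (simp add: unitary_def)
qed

lemma unitary_ppart: "Factorial_Ring.prime x \<Longrightarrow> unitary (ppart x)"
  using unitaryI[OF ppart_pcopart] coprime_ppart_pcopart by blast

lemma unitary_pcopart: "Factorial_Ring.prime x \<Longrightarrow> unitary (pcopart x)"
  using unitaryI[of "pcopart x" "ppart x"] ppart_pcopart coprime_ppart_pcopart
  by (simp add: mult.commute coprime_commute)

lemma ppart_dvd_pcopart:
  assumes "Factorial_Ring.prime x" "Factorial_Ring.prime y" "x \<noteq> y"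
  shows "ppart x dvd pcopart y"
proof -
  have "coprime (ppart x) (ppart y)"
    unfolding ppart_def using primes_coprime[OF assms] by simp
  moreover have "ppart x dvd ppart y * pcopart y"
    unfolding ppart_pcopart by (metis ppart_pcopart dvd_triv_left)
  ultimately show ?thesis
    by (simp add: coprime_dvd_mult_right_iff)
qed

lemma unitary_pow_mem:
  assumes "unitary k" "subgroup N G" "g \<in> carrier G" "g [^] (k * k) \<in> N"
  shows "g [^] k \<in> N"
  using pow_gcd_order_mem[OF assms(2-4)] assms(1) by (simp add: unitary_def)

lemma powers_in_trans:
  assumes "unitary k" "subgroup A G" "subgroup N G" "powers_in k A B" "powers_in k B N"
  shows "powers_in k A N"
  unfolding powers_in_def
proof
  fix a assume a: "a \<in> A"
  then have "a \<in> carrier G" "(a [^] k) [^] k \<in> N"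
    using assms by (auto simp: powers_in_def subgroup.mem_carrier)
  then show "a [^] k \<in> N"
    using unitary_pow_mem[OF assms(1,3)] by (simp add: nat_pow_pow)
qed

lemma powers_in_mult:
  assumes "normal_in N H" "A \<subseteq> H" "powers_in k A N" "M \<subseteq> N"
  shows "powers_in k (A <#> M) N"
  unfolding powers_in_def
proof
  fix g assume "g \<in> A <#> M"
  then obtain a m where "a \<in> A" "m \<in> M" "g = a \<otimes> m"
    unfolding mem_set_mult by blast
  then show "g [^] k \<in> N"
    using pow_mem_mult_normal_in(2)[OF assms(1), of a m k] assms unfolding powers_in_def by blast
qed

lemma powers_in_mono: "powers_in k A N \<Longrightarrow> A' \<subseteq> A \<Longrightarrow> N \<subseteq> N' \<Longrightarrow> powers_in k A' N'"
  unfolding powers_in_def by blast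

lemma powers_in_self: "subgroup N G \<Longrightarrow> powers_in k N N"
  unfolding powers_in_def using subgroup_pow_closed by blast

text \<open>For \<open>k\<close> the \<open>x\<close>-part or the \<open>x'\<close>-part of \<open>|G|\<close>, this
is the preimage in \<open>H\<close> of \<open>O\<^bsub>x\<^esub>(H/N)\<close> or
\<open>O\<^bsub>x'\<^esub>(H/N)\<close>.\<close>

definition radical :: "nat \<Rightarrow> 'a set \<Rightarrow> 'a set \<Rightarrow> 'a set"
  where "radical k H N = \<Union>{A. normal_in A H \<and> N \<subseteq> A \<and> powers_in k A N}"

lemma radical_greatest:
  assumes "normal_in A H" "N \<subseteq> A" "powers_in k A N"
  shows "A \<subseteq> radical k H N"
  using assms unfolding radical_def by blast

text \<open>Extensions stay in the class, hence so do products \<open>A B\<close> of normal subgroups; this makes the union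
in the definition of the radical directed.\<close>

lemma radical_join:
  assumes "unitary k" "normal_in N H"
    and "normal_in A H" "N \<subseteq> A" "powers_in k A N"
    and "normal_in B H" "N \<subseteq> B" "powers_in k B N"
  shows "normal_in (A <#> B) H \<and> N \<subseteq> A <#> B \<and> powers_in k (A <#> B) N
    \<and> A \<subseteq> A <#> B \<and> B \<subseteq> A <#> B"
proof -
  note a = normal_inD[OF assms(3)] and b = normal_inD[OF assms(6)]
  note ab = set_mult_subgroup_normal_in[OF a(2,3) assms(6)]
  have "powers_in k (A <#> B) B"
    using powers_in_mult[OF assms(6) a(3) powers_in_mono[OF assms(5) subset_refl assms(7)]] by blast
  then have "powers_in k (A <#> B) N"
    using powers_in_trans[OF assms(1) ab(1) normal_inD(2)[OF assms(2)]] assms(8) by blast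
  then show ?thesis
    using ab assms(4) normal_in_set_mult[OF assms(3,6)] by blast
qed

lemma radical_pair:
  assumes "unitary k" "normal_in N H" "a \<in> radical k H N" "b \<in> radical k H N"
  obtains C where "normal_in C H" "N \<subseteq> C" "powers_in k C N" "a \<in> C" "b \<in> C"
proof -
  obtain A where A: "normal_in A H" "N \<subseteq> A" "powers_in k A N" "a \<in> A"
    using assms(3) unfolding radical_def by blast
  obtain B where B: "normal_in B H" "N \<subseteq> B" "powers_in k B N" "b \<in> B"
    using assms(4) unfolding radical_def by blast
  show thesis
    using radical_join[OF assms(1,2) A(1-3) B(1-3)] A(4) B(4) that by blast
qed

lemma subset_radical:
  assumes "normal_in N H"
  shows "N \<subseteq> radical k H N"
  using radical_greatest[OF assms] powers_in_self normal_inD[OF assms] by blast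

lemma powers_in_radical: "powers_in k (radical k H N) N"
  unfolding radical_def powers_in_def by blast

lemma radical_subset: "radical k H N \<subseteq> H"
  unfolding radical_def using normal_inD(3) by blast

lemma subgroup_radical:
  assumes "unitary k" "normal_in N H"
  shows "subgroup (radical k H N) G"
proof (rule subgroupI)
  show "radical k H N \<subseteq> carrier G"
    using radical_subset normal_inD(1)[OF assms(2)] subgroup.subset by blast
  show "radical k H N \<noteq> {}"
    using subset_radical[OF assms(2)] subgroup.one_closed[OF normal_inD(2)[OF assms(2)]] by blast
next
  fix a b assume "a \<in> radical k H N" "b \<in> radical k H N"
  then obtain C where C: "normal_in C H" "N \<subseteq> C" "powers_in k C N" "a \<in> C" "b \<in> C"
    using radical_pair[OF assms] by metis
  then show "a \<otimes> b \<in> radical k H N"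
    using radical_greatest[OF C(1-3)] subgroup.m_closed[OF normal_inD(2)[OF C(1)]] by blast
next
  fix a assume a: "a \<in> radical k H N"
  obtain C where C: "normal_in C H" "N \<subseteq> C" "powers_in k C N" "a \<in> C"
    using radical_pair[OF assms a a] by metis
  then show "inv a \<in> radical k H N"
    using radical_greatest[OF C(1-3)] subgroup.m_inv_closed[OF normal_inD(2)[OF C(1)]] by blast
qed

lemma conj_mem_iff:
  assumes "g \<in> carrier G" "x \<in> carrier G" "A \<subseteq> carrier G"
  shows "x \<in> (\<lambda>a. g \<otimes> a \<otimes> inv g) ` A \<longleftrightarrow> inv g \<otimes> x \<otimes> g \<in> A"
proof
  assume "x \<in> (\<lambda>a. g \<otimes> a \<otimes> inv g) ` A"
  then obtain a where "a \<in> A" "x = g \<otimes> a \<otimes> inv g"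
    by blast
  moreover from this have "a \<in> carrier G"
    using assms by blast
  ultimately show "inv g \<otimes> x \<otimes> g \<in> A"
    using assms by (simp add: m_assoc)
next
  assume "inv g \<otimes> x \<otimes> g \<in> A"
  moreover have "x = g \<otimes> (inv g \<otimes> x \<otimes> g) \<otimes> inv g"
    using assms by (simp add: m_assoc)
  ultimately show "x \<in> (\<lambda>a. g \<otimes> a \<otimes> inv g) ` A"
    by blast
qed

lemma conj_pow:
  assumes "g \<in> carrier G" "x \<in> carrier G"
  shows "(g \<otimes> x \<otimes> inv g) [^] (k::nat) = g \<otimes> x [^] k \<otimes> inv g"
  by (induction k) (use assms in \<open>simp_all add: m_assoc\<close>)

lemma conj_mult:
  assumes "g \<in> carrier G" "x \<in> carrier G" "y \<in> carrier G"
  shows "g \<otimes> (x \<otimes> y) \<otimes> inv g = (g \<otimes> x \<otimes> inv g) \<otimes> (g \<otimes> y \<otimes> inv g)"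
  using assms by (simp add: m_assoc)

lemma normal_in_conj_image:
  assumes "normal_in A H" "normal_in H L" "g \<in> L"
  shows "normal_in ((\<lambda>a. g \<otimes> a \<otimes> inv g) ` A) H"
proof -
  note a = normal_inD[OF assms(1)] and h = normal_inD[OF assms(2)]
  have gc: "g \<in> carrier G"
    using h(1) assms(3) by (rule subgroup.mem_carrier)
  have ac: "x \<in> carrier G" if "x \<in> A" for x
    using a(2) that by (rule subgroup.mem_carrier)
  have sub: "(\<lambda>a. g \<otimes> a \<otimes> inv g) ` A \<subseteq> H"
    using h(4)[OF assms(3)] a(3) by blast
  show ?thesis
  proof (rule normal_inI[OF a(1) _ sub])
    show "subgroup ((\<lambda>a. g \<otimes> a \<otimes> inv g) ` A) G"
    proof (rule subgroupI)
      show "(\<lambda>a. g \<otimes> a \<otimes> inv g) ` A \<subseteq> carrier G" "(\<lambda>a. g \<otimes> a \<otimes> inv g) ` A \<noteq> {}"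
        using ac gc subgroup.one_closed[OF a(2)] by auto
    next
      fix x assume "x \<in> (\<lambda>a. g \<otimes> a \<otimes> inv g) ` A"
      then obtain a where x: "a \<in> A" "x = g \<otimes> a \<otimes> inv g"
        by blast
      then have "inv x = g \<otimes> inv a \<otimes> inv g"
        using ac gc by (simp add: inv_mult_group m_assoc)
      then show "inv x \<in> (\<lambda>a. g \<otimes> a \<otimes> inv g) ` A"
        using subgroup.m_inv_closed[OF a(2) x(1)] by blast
    next
      fix x y assume "x \<in> (\<lambda>a. g \<otimes> a \<otimes> inv g) ` A" "y \<in> (\<lambda>a. g \<otimes> a \<otimes> inv g) ` A"
      then obtain a b where x: "a \<in> A" "x = g \<otimes> a \<otimes> inv g" "b \<in> A" "y = g \<otimes> b \<otimes> inv g"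
        by blast
      then have "x \<otimes> y = g \<otimes> (a \<otimes> b) \<otimes> inv g"
        using ac gc by (simp add: m_assoc)
      then show "x \<otimes> y \<in> (\<lambda>a. g \<otimes> a \<otimes> inv g) ` A"
        using subgroup.m_closed[OF a(2) x(1,3)] by blast
    qed
    fix k x assume k: "k \<in> H" and "x \<in> (\<lambda>a. g \<otimes> a \<otimes> inv g) ` A"
    then obtain b where x: "b \<in> A" "x = g \<otimes> b \<otimes> inv g"
      by blast
    define k' where "k' = inv g \<otimes> k \<otimes> g"
    have k': "k' \<in> H"
      unfolding k'_def using normal_in_conj_inv[OF assms(2,3) k] .
    have kc: "k \<in> carrier G"
      using a(1) k by (rule subgroup.mem_carrier)
    have "k \<otimes> x \<otimes> inv k = g \<otimes> (k' \<otimes> b \<otimes> inv k') \<otimes> inv g"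
      unfolding k'_def using x ac gc kc by (simp add: inv_mult_group m_assoc)
    then show "k \<otimes> x \<otimes> inv k \<in> (\<lambda>a. g \<otimes> a \<otimes> inv g) ` A"
      using a(4)[OF k' x(1)] by blast
  qed
qed

text \<open>The radical is invariant under all automorphisms of \<open>H\<close> that preserve \<open>N\<close>.
Here they are conjugations by elements of \<open>L\<close>: they permute the subgroups whose union is
the radical.\<close>

lemma normal_in_radical_super:
  assumes "unitary k" "normal_in N H" "normal_in H L" "normal_in N L"
  shows "normal_in (radical k H N) L"
proof (rule normal_inI)
  note h = normal_inD[OF assms(3)] and n = normal_inD[OF assms(4)]
  show "subgroup L G"
    by (rule h)
  show "subgroup (radical k H N) G"
    by (rule subgroup_radical[OF assms(1,2)])
  show "radical k H N \<subseteq> L"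
    using radical_subset h(3) by blast
  fix g x assume g: "g \<in> L" and x: "x \<in> radical k H N"
  obtain C where C: "normal_in C H" "N \<subseteq> C" "powers_in k C N" "x \<in> C"
    using radical_pair[OF assms(1,2) x x] by metis
  let ?C = "(\<lambda>a. g \<otimes> a \<otimes> inv g) ` C"
  have gc: "g \<in> carrier G"
    using h(1) g by (rule subgroup.mem_carrier)
  have cc: "C \<subseteq> carrier G"
    using normal_inD(2)[OF C(1)] by (rule subgroup.subset)
  have "normal_in ?C H"
    using normal_in_conj_image[OF C(1) assms(3) g] .
  moreover have "N \<subseteq> ?C"
  proof
    fix m assume m: "m \<in> N"
    have "inv g \<otimes> m \<otimes> g \<in> C"
      using normal_in_conj_inv[OF assms(4) g m] C(2) by blast
    then show "m \<in> ?C"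
      using conj_mem_iff[OF gc _ cc] m subgroup.mem_carrier[OF n(2)] by blast
  qed
  moreover have "powers_in k ?C N"
    unfolding powers_in_def
  proof
    fix y assume "y \<in> ?C"
    then obtain c where c: "c \<in> C" "y = g \<otimes> c \<otimes> inv g"
      by blast
    then show "y [^] k \<in> N"
      using conj_pow[OF gc] cc n(4)[OF g] C(3) unfolding powers_in_def by auto
  qed
  ultimately show "g \<otimes> x \<otimes> inv g \<in> radical k H N"
    using radical_greatest C(4) by blast
qed

lemma normal_in_radical:
  assumes "unitary k" "normal_in N H"
  shows "normal_in (radical k H N) H"
  using normal_in_radical_super[OF assms normal_in_refl assms(2)] normal_inD(1)[OF assms(2)] by blast

text \<open>The quotient of \<open>H\<close> by its radical has a trivial radical.\<close>

lemma radical_closed: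
  assumes "unitary k" "normal_in N H" 
    and "normal_in F H" "radical k H N \<subseteq> F" "powers_in k F (radical k H N)"
  shows "F \<subseteq> radical k H N"
proof (rule radical_greatest[OF assms(3)])
  show "N \<subseteq> F"
    using subset_radical[OF assms(2)] assms(4) by blast
  show "powers_in k F N"
    using powers_in_trans[OF assms(1) normal_inD(2)[OF assms(3)] normal_inD(2)[OF assms(2)] assms(5)]
      powers_in_radical by blast
qed

section \<open>The Hall-Higman centralizer lemma\<close>

lemma comm_in_derived:
  assumes "a \<in> A" "b \<in> A"
  shows "comm a b \<in> derived G A"
  unfolding derived_def comm_def using assms by (auto intro!: generate.incl)

lemma normal_in_derived:
  assumes "normal_in A H"
  shows "normal_in (derived G A) H"
proof -
  note a = normal_inD[OF assms]
  interpret H: group "G\<lparr>carrier := H\<rparr>"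
    using a(1) by (rule subgroup_imp_group)
  show ?thesis
    using H.derived_is_normal[of A] assms derived_consistent[OF a(3,1)]
    unfolding normal_in_iff_normal[OF a(1)] by metis
qed

lemma derived_subset_of:
  assumes "subgroup A G"
  shows "derived G A \<subseteq> A"
  using assms derived_incl by blast

text \<open>\<open>D\<close> is the last term of the derived series of \<open>C\<close> that is not contained in
\<open>M\<close>.\<close>

lemma solvable_chain_step:
  assumes "(derived G ^^ n) (carrier G) = {\<one>}"
    and "normal_in C H" "subgroup M G" "\<not> C \<subseteq> M"
  obtains D where "normal_in D H" "D \<subseteq> C" "\<not> D \<subseteq> M" "derived G D \<subseteq> M"
proof -
  have norm: "normal_in ((derived G ^^ i) C) H" for i
    by (induction i) (use assms(2) normal_in_derived in auto)
  have sub: "(derived G ^^ i) C \<subseteq> C" for i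
  proof (induction i)
    case (Suc i)
    then show ?case
      using derived_subset_of[OF normal_inD(2)[OF norm[of i]]] by auto
  qed simp
  have "(derived G ^^ n) C \<subseteq> (derived G ^^ n) (carrier G)"
    using mono_exp_of_derived subgroup.subset[OF normal_inD(2)[OF assms(2)]] by blast
  then have last: "(derived G ^^ n) C \<subseteq> M"
    using assms(1) subgroup.one_closed[OF assms(3)] by auto
  define i where "i = (LEAST i. (derived G ^^ i) C \<subseteq> M)"
  have i: "(derived G ^^ i) C \<subseteq> M"
    unfolding i_def using last by (rule LeastI)
  then have "i \<noteq> 0"
    using assms(4) by (metis funpow_0)
  then obtain j where j: "i = Suc j"
    using not0_implies_Suc by blast
  then have "\<not> (derived G ^^ j) C \<subseteq> M"
    using not_less_Least[of j "\<lambda>i. (derived G ^^ i) C \<subseteq> M"] unfolding i_def by auto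
  then show thesis
    using that[OF norm sub, of j] i j by simp
qed

text \<open>The hypothesis says that \<open>D/K\<close> is abelian, so that taking \<open>k\<close>-th powers is an
endomorphism of it.\<close>

lemma normal_in_power_kernel:
  assumes "normal_in D H" "normal_in K H" "K \<subseteq> D"
    and "\<And>a b. a \<in> D \<Longrightarrow> b \<in> D \<Longrightarrow> comm a b \<in> K"
  shows "normal_in {d \<in> D. d [^] (k::nat) \<in> K} H"
proof -
  note d = normal_inD[OF assms(1)] and n = normal_inD[OF assms(2)]
  have dc: "x \<in> carrier G" if "x \<in> D" for x
    using d(2) that by (rule subgroup.mem_carrier)
  have KD: "normal_in K D"
    using normal_in_between[OF assms(2) d(2,3) assms(3)] .
  note q = section_quotient[OF KD]
  let ?Q = "G\<lparr>carrier := D\<rparr> Mod K"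
  interpret Q: comm_group ?Q
  proof (rule group.group_comm_groupI[OF q(1)])
    fix x y assume "x \<in> carrier ?Q" "y \<in> carrier ?Q"
    then obtain a b where "a \<in> D" "x = K #> a" "b \<in> D" "y = K #> b"
      unfolding q(2) by blast
    then show "x \<otimes>\<^bsub>?Q\<^esub> y = y \<otimes>\<^bsub>?Q\<^esub> x"
      using assms(4) comm_mem_iff_section[OF KD] by (simp add: q(3) del: mult_FactGroup)
  qed
  have iff: "d [^] k \<in> K \<longleftrightarrow> (K #> d) [^]\<^bsub>?Q\<^esub> k = \<one>\<^bsub>?Q\<^esub>" if "d \<in> D" for d
    using that q(5,6,7) subgroup_pow_closed[OF d(2)] by simp
  have qc: "K #> d \<in> carrier ?Q" if "d \<in> D" for d
    using that q(2) by blast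
  show ?thesis
  proof (rule normal_inI)
    show "subgroup {d \<in> D. d [^] k \<in> K} G"
    proof (rule subgroupI)
      show "{d \<in> D. d [^] k \<in> K} \<subseteq> carrier G"
        using dc by blast
      show "{d \<in> D. d [^] k \<in> K} \<noteq> {}"
        using subgroup.one_closed[OF d(2)] subgroup.one_closed[OF n(2)] by fastforce
    next
      fix a assume "a \<in> {d \<in> D. d [^] k \<in> K}"
      then show "inv a \<in> {d \<in> D. d [^] k \<in> K}"
        using subgroup.m_inv_closed[OF d(2)] subgroup.m_inv_closed[OF n(2)] dc
        by (simp add: nat_pow_inv)
    next
      fix a b assume ab: "a \<in> {d \<in> D. d [^] k \<in> K}" "b \<in> {d \<in> D. d [^] k \<in> K}"
      then have "(K #> a) [^]\<^bsub>?Q\<^esub> k = \<one>\<^bsub>?Q\<^esub>" "(K #> b) [^]\<^bsub>?Q\<^esub> k = \<one>\<^bsub>?Q\<^esub>"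
        "K #> a \<in> carrier ?Q" "K #> b \<in> carrier ?Q"
        using iff qc by blast+
      then have "((K #> a) \<otimes>\<^bsub>?Q\<^esub> (K #> b)) [^]\<^bsub>?Q\<^esub> k = \<one>\<^bsub>?Q\<^esub>"
        using Q.nat_pow_distrib by (simp del: mult_FactGroup one_FactGroup)
      then show "a \<otimes> b \<in> {d \<in> D. d [^] k \<in> K}"
        using ab iff[of "a \<otimes> b"] subgroup.m_closed[OF d(2)] q(3)
        by (simp del: mult_FactGroup one_FactGroup)
    qed
    fix h x assume h: "h \<in> H" and x: "x \<in> {d \<in> D. d [^] k \<in> K}"
    then show "h \<otimes> x \<otimes> inv h \<in> {d \<in> D. d [^] k \<in> K}"
      using d(4) n(4) conj_pow dc subgroup.mem_carrier[OF d(1)] by simp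
  qed (use d in auto)
qed

text \<open>The images of \<open>A\<close> and \<open>A K\<close> in \<open>H/K\<close> coincide.\<close>

lemma comm_mod_set_mult:
  assumes "normal_in K H" "A \<subseteq> H"
    and "\<And>a b. a \<in> A \<Longrightarrow> b \<in> A \<Longrightarrow> comm a b \<in> K"
    and "a \<in> A <#> K" "b \<in> A <#> K"
  shows "comm a b \<in> K"
proof -
  note q = section_quotient[OF assms(1)] and n = normal_inD[OF assms(1)]
  interpret Q: group "G\<lparr>carrier := H\<rparr> Mod K"
    by (rule q)
  have red: "\<exists>a\<in>A. K #> x = K #> a \<and> x \<in> H" if "x \<in> A <#> K" for x
  proof -
    obtain a m where x: "a \<in> A" "m \<in> K" "x = a \<otimes> m"
      using \<open>x \<in> A <#> K\<close> unfolding mem_set_mult by blast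
    then have "a \<in> H" "m \<in> H"
      using assms(2) n(3) by auto
    moreover from this have "K #> a \<in> carrier (G\<lparr>carrier := H\<rparr> Mod K)"
      using q(2) by blast
    ultimately have "K #> x = K #> a" "x \<in> H"
      using q(3)[of a m] q(7)[of m] x q(6) Q.r_one[of "K #> a"] subgroup.m_closed[OF n(1)] by auto
    then show ?thesis
      using x(1) by blast
  qed
  obtain a' where a: "a' \<in> A" "K #> a = K #> a'" "a \<in> H"
    using red[OF assms(4)] by blast
  obtain b' where b: "b' \<in> A" "K #> b = K #> b'" "b \<in> H"
    using red[OF assms(5)] by blast
  have "K #> (a' \<otimes> b') = K #> (b' \<otimes> a')"
    using comm_mem_iff_section[OF assms(1)] assms(2,3) a(1) b(1) by blast
  moreover have "a' \<in> H" "b' \<in> H"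
    using a b assms(2) by auto
  ultimately have "K #> (a \<otimes> b) = K #> (b \<otimes> a)"
    using a b by (simp flip: q(3))
  then show ?thesis
    using comm_mem_iff_section[OF assms(1) a(3) b(3)] by blast
qed

text \<open>The lemma of Hall and Higman, in the situation where \<open>M/K\<close> is an \<open>x\<close>-group and
neither a normal \<open>x'\<close>-subgroup of \<open>G/K\<close> nor a normal \<open>x\<close>-subgroup
of \<open>G/M\<close> is left; \<open>k\<close> and \<open>l\<close> are the \<open>x\<close>-part and
the \<open>x'\<close>-part of \<open>|G|\<close>. If the centralizer of \<open>M/K\<close> were not
contained in \<open>M\<close>, it would contain a normal subgroup \<open>D\<close> of \<open>G\<close>
whose derived subgroup lies in \<open>M\<close> but which does not itself lie in \<open>M\<close>. The
elements of \<open>D\<close> whose order modulo \<open>M\<close> is prime to \<open>x\<close> have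
commutators in \<open>M\<close> that are central modulo \<open>K\<close>. Such a commutator is killed
modulo \<open>K\<close> by \<open>l\<close> and by \<open>k\<close>, hence trivial, and these elements
form an abelian group modulo \<open>K\<close>. Its \<open>x'\<close>-part is a normal
\<open>x'\<close>-subgroup, hence trivial. It follows that \<open>D M/M\<close> is a nontrivial normal
\<open>x\<close>-subgroup, which is impossible.\<close>

lemma centralizer_mod_subset:
  assumes "(derived G ^^ n) (carrier G) = {\<one>}"
    and "k * l = order G" "coprime k l"
    and K: "normal_in K (carrier G)" and M: "normal_in M (carrier G)"
    and "K \<subseteq> M" "powers_in k M K"
    and no_l: "\<And>F. normal_in F (carrier G) \<Longrightarrow> K \<subseteq> F \<Longrightarrow> powers_in l F K \<Longrightarrow> F \<subseteq> K"
    and no_k: "\<And>F. normal_in F (carrier G) \<Longrightarrow> M \<subseteq> F \<Longrightarrow> powers_in k F M \<Longrightarrow> F \<subseteq> M"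
  shows "centralizer_mod (carrier G) M K \<subseteq> M"
proof (rule ccontr)
  assume not: "\<not> ?thesis"
  note kn = normal_inD[OF K] and mn = normal_inD[OF M]
  let ?C = "centralizer_mod (carrier G) M K"
  have C: "normal_in ?C (carrier G)"
    using K M by (rule normal_in_centralizer_mod)
  obtain D where D: "normal_in D (carrier G)" "D \<subseteq> ?C" "\<not> D \<subseteq> M" "derived G D \<subseteq> M"
    using solvable_chain_step[OF assms(1) C mn(2) not] .
  note d = normal_inD[OF D(1)]
  have dc: "x \<in> carrier G" if "x \<in> D" for x
    using d(2) that by (rule subgroup.mem_carrier)
  have DM: "comm a b \<in> M" if "a \<in> D" "b \<in> D" for a b
    using comm_in_derived[OF that] D(4) by blast
  have central: "comm a y \<in> K" if "a \<in> D" "y \<in> M" for a y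
    using that D(2) by (auto simp: centralizer_mod_def)
  \<comment> \<open>The elements whose order modulo \<open>M\<close> is prime to \<open>x\<close>; \<open>D M/M\<close> is abelian, so they form a subgroup.\<close>
  define E where "E = {d \<in> D <#> M. d [^] l \<in> M}"
  have DMnorm: "normal_in (D <#> M) (carrier G)"
    using normal_in_set_mult[OF D(1) M] .
  note DMs = set_mult_subgroup_normal_in[OF d(2,3) M]
  have DM_comm: "comm a b \<in> M" if "a \<in> D <#> M" "b \<in> D <#> M" for a b
    using comm_mod_set_mult[OF M d(3) DM that] .
  have "normal_in {d \<in> D <#> M. d [^] l \<in> M} (carrier G)"
    using normal_in_power_kernel[OF DMnorm M DMs(3) DM_comm] by blast
  then have E: "normal_in (D \<inter> E) (carrier G)"
    using normal_in_Int[OF D(1)] unfolding E_def by blast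
  have Emem: "a \<in> D \<inter> E \<longleftrightarrow> a \<in> D \<and> a [^] l \<in> M" for a
    using DMs(2) by (auto simp: E_def)
  have EK: "comm a b \<in> K" if a: "a \<in> D \<inter> E" and b: "b \<in> D \<inter> E" for a b
  proof -
    have ab: "a \<in> D" "b \<in> D" "a [^] l \<in> M" "a \<in> carrier G" "b \<in> carrier G"
      using a b Emem dc by auto
    have c: "comm a b \<in> M"
      using DM ab by blast
    obtain m where m: "m \<in> K" "comm (a [^] l) b = m \<otimes> comm a b [^] l"
      using comm_pow_normal_in[OF K ab(4,5) central[OF ab(1) c], of l] by blast
    have "comm (a [^] l) b \<in> K"
      using central[OF ab(2,3)] inv_comm[of b "a [^] l"] ab subgroup.m_inv_closed[OF kn(2)]
      by (metis nat_pow_closed)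
    moreover have mc: "m \<in> carrier G" "comm a b \<in> carrier G"
      using m(1) kn(2) c mn(2) by (auto simp: subgroup.mem_carrier)
    moreover have "comm a b [^] l = inv m \<otimes> comm (a [^] l) b"
      using m(2) mc by simp
    ultimately have "comm a b [^] l \<in> K"
      using m(1) subgroup.m_closed[OF kn(2)] subgroup.m_inv_closed[OF kn(2)] by simp
    moreover have "comm a b [^] k \<in> K"
      using c assms(7) by (simp add: powers_in_def)
    ultimately show "comm a b \<in> K"
      using coprime_pow_mem[OF kn(2) mc(2)] assms(3) by blast
  qed
  define EK where "EK = (D \<inter> E) <#> K"
  have e: "D \<inter> E \<subseteq> carrier G"
    using dc by blast
  note EKs = set_mult_subgroup_normal_in[OF normal_inD(2)[OF E] e K, folded EK_def]
  have EKn: "normal_in EK (carrier G)"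
    unfolding EK_def using normal_in_set_mult[OF E K] .
  have EKc: "comm a b \<in> K" if "a \<in> EK" "b \<in> EK" for a b
    using comm_mod_set_mult[OF K e EK] that unfolding EK_def by blast
  \<comment> \<open>The \<open>x'\<close>-part of the abelian group \<open>EK/K\<close>.\<close>
  define F where "F = {d \<in> EK. d [^] l \<in> K}"
  have F: "normal_in F (carrier G)"
    unfolding F_def using normal_in_power_kernel[OF EKn K EKs(3) EKc] by blast
  have "F \<subseteq> K"
    using no_l[OF F] EKs(3) subgroup_pow_closed[OF kn(2)] by (auto simp: F_def powers_in_def)
  have EM: "a \<in> M" if a: "a \<in> D \<inter> E" for a
  proof -
    have ac: "a \<in> carrier G" and al: "a [^] l \<in> M"
      using a Emem e by auto
    have "a [^] k \<in> D \<inter> E"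
      using subgroup_pow_closed[OF normal_inD(2)[OF E] a] .
    moreover have "(a [^] k) [^] l \<in> K"
      using pow_order_eq_1[OF ac] ac assms(2) subgroup.one_closed[OF kn(2)] by (simp add: nat_pow_pow)
    ultimately have "a [^] k \<in> F"
      using EKs(2) by (auto simp: F_def)
    then have "a [^] k \<in> M"
      using \<open>F \<subseteq> K\<close> assms(6) by blast
    then show ?thesis
      using coprime_pow_mem[OF mn(2) ac _ al] assms(3) by blast
  qed
  have "powers_in k D M"
    unfolding powers_in_def
  proof
    fix a assume a: "a \<in> D"
    have "(a [^] k) [^] l \<in> M"
      using pow_order_eq_1[OF dc[OF a]] dc[OF a] assms(2) subgroup.one_closed[OF mn(2)]
      by (simp add: nat_pow_pow)
    then show "a [^] k \<in> M"
      using EM Emem subgroup_pow_closed[OF d(2) a] by blast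
  qed
  then have "powers_in k (D <#> M) M"
    using powers_in_mult[OF M d(3)] by blast
  then have "D <#> M \<subseteq> M"
    using no_k[OF DMnorm] DMs(3) by blast
  then show False
    using D(3) DMs(2) by blast
qed

end

section \<open>Omitted words\<close>

text \<open>A Hall \<open>r'\<close>-subgroup does not see the sections belonging to \<open>r\<close>, and two
sections for the same prime with nothing left in between form a single one.\<close>

definition delete_letter :: "nat \<Rightarrow> nat list \<Rightarrow> nat list"
  where "delete_letter r w = remdups_adj (filter (\<lambda>y. y \<noteq> r) w)"

context fin_group
begin

text \<open>Words are read from the bottom of the group to its top. The section \<open>H/N\<close> omits
\<open>x\<^sub>1 \<dots> x\<^sub>n\<close> if it has a normal series with factors an
\<open>x\<^sub>1'\<close>-group, an \<open>x\<^sub>1\<close>-group, \<open>\<dots>\<close>, an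
\<open>x\<^sub>n'\<close>-group. The first alternative is the last step of such a series: as no section
omits the empty word, it is the only alternative for a single letter.\<close>

fun omits :: "nat list \<Rightarrow> 'a set \<Rightarrow> 'a set \<Rightarrow> bool"
  where
    "omits [] H N \<longleftrightarrow> False"
  | "omits (x # u) H N \<longleftrightarrow> normal_in N H \<and>
      (powers_in (pcopart x) H N \<or>
       (\<exists>A B. normal_in A H \<and> normal_in B H \<and> N \<subseteq> A \<and> A \<subseteq> B \<and>
         powers_in (pcopart x) A N \<and> powers_in (ppart x) B A \<and> omits u H B))"

lemma omits_self:
  assumes "subgroup H G" "w \<noteq> []"
  shows "omits w H H"
  using assms normal_in_refl powers_in_self by (cases w) auto

text \<open>Passing to quotients of \<open>H/N\<close>: multiply the whole series by \<open>N'\<close>.\<close>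

lemma omits_mono:
  assumes "omits w H N" "N \<subseteq> N'" "normal_in N' H"
  shows "omits w H N'"
  using assms
proof (induction w arbitrary: N N')
  case (Cons x u)
  consider "powers_in (pcopart x) H N"
    | A B where "normal_in A H" "normal_in B H" "N \<subseteq> A" "A \<subseteq> B"
        "powers_in (pcopart x) A N" "powers_in (ppart x) B A" "omits u H B"
    using Cons.prems(1) by auto
  then show ?case
  proof cases
    case 1
    then show ?thesis
      using Cons.prems powers_in_mono[OF 1 subset_refl] by simp
  next
    case (2 A B)
    note a = normal_inD[OF 2(1)] and b = normal_inD[OF 2(2)]
    let ?A = "A <#> N'" and ?B = "B <#> N'"
    note am = set_mult_subgroup_normal_in[OF a(2,3) Cons.prems(3)]
    note bm = set_mult_subgroup_normal_in[OF b(2,3) Cons.prems(3)]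
    have A: "normal_in ?A H" and B: "normal_in ?B H"
      using normal_in_set_mult 2 Cons.prems(3) by auto
    have "?A \<subseteq> ?B"
      using 2(4) by (rule mono_set_mult) simp
    moreover have "powers_in (pcopart x) ?A N'"
      using powers_in_mult[OF Cons.prems(3) a(3) powers_in_mono[OF 2(5) subset_refl Cons.prems(2)]]
      by blast
    moreover have "powers_in (ppart x) ?B ?A"
      using powers_in_mult[OF A b(3) powers_in_mono[OF 2(6) subset_refl am(2)] am(3)] .
    moreover have "omits u H ?B"
      using Cons.IH[OF 2(7) bm(2) B] .
    ultimately show ?thesis
      using A B am(3) Cons.prems(3) by auto
  qed
qed simp

text \<open>An \<open>x\<close>-group is an \<open>s'\<close>-group if \<open>x\<close> and \<open>s\<close> are
different primes.\<close>

lemma powers_in_pcopart_absorb: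
  assumes "Factorial_Ring.prime x" "Factorial_Ring.prime s" "x \<noteq> s"
    and "subgroup A G" "subgroup N G" "powers_in (pcopart s) A B" "powers_in (ppart x) B N"
  shows "powers_in (pcopart s) A N"
  unfolding powers_in_def
proof
  fix a assume a: "a \<in> A"
  then have ac: "a \<in> carrier G"
    using assms(4) by (simp add: subgroup.mem_carrier)
  obtain c where c: "pcopart s = ppart x * c"
    using ppart_dvd_pcopart[OF assms(1-3)] by blast
  have "a [^] (pcopart s * ppart x) \<in> N"
    using a ac assms(6,7) by (simp add: powers_in_def flip: nat_pow_pow)
  then have "(a [^] (pcopart s * ppart x)) [^] c \<in> N"
    using assms(5) subgroup_pow_closed by blast
  then have "a [^] (pcopart s * pcopart s) \<in> N"
    using ac c by (metis mult.assoc nat_pow_pow)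
  then show "a [^] pcopart s \<in> N"
    using unitary_pow_mem[OF unitary_pcopart[OF assms(2)] assms(5) ac] by blast
qed

text \<open>The series for the word \<open>s u\<close> starts with an \<open>s'\<close>-group, which can absorb an
\<open>x\<close>-group from below.\<close>

lemma omits_absorb:
  assumes "omits (s # u) H B" "normal_in N H" "N \<subseteq> B" "powers_in (ppart x) B N"
    and "Factorial_Ring.prime x" "Factorial_Ring.prime s" "x \<noteq> s"
  shows "omits (s # u) H N"
proof -
  note n = normal_inD[OF assms(2)]
  consider "powers_in (pcopart s) H B"
    | A C where "normal_in A H" "normal_in C H" "B \<subseteq> A" "A \<subseteq> C"
        "powers_in (pcopart s) A B" "powers_in (ppart s) C A" "omits u H C"
    using assms(1) by auto
  then show ?thesis
  proof cases
    case 1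
    then show ?thesis
      using powers_in_pcopart_absorb[OF assms(5-7) n(1,2) 1 assms(4)] assms(2) by simp
  next
    case (2 A C)
    have "powers_in (pcopart s) A N"
      using powers_in_pcopart_absorb[OF assms(5-7) normal_inD(2)[OF 2(1)] n(2) 2(5) assms(4)] .
    moreover have "N \<subseteq> A"
      using assms(3) 2(3) by blast
    ultimately show ?thesis
      using 2 assms(2) by auto
  qed
qed

lemma normal_in_carrier_iff: "normal_in N (carrier G) \<longleftrightarrow> N \<lhd> G"
  using normal_in_iff_normal[OF subgroup_self] by simp

section \<open>Subgroups of prime power index\<close>

text \<open>Both sides compare, through the second isomorphism theorem, the index of \<open>M\<close> in \<open>M H\<close>.\<close>

lemma product_formula:
  assumes "normal_in M (carrier G)" "subgroup H G"
  shows "card H * card M = card (M <#> H) * card (M \<inter> H)" "subgroup (M <#> H) G"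
proof -
  note m = normal_inD[OF assms(1)]
  have "M \<lhd> G"
    using assms(1) normal_in_carrier_iff by blast
  then interpret iso: second_isomorphism_grp M G H
    using assms(2) by (simp add: second_isomorphism_grp_def second_isomorphism_grp_axioms_def)
  show MH: "subgroup (M <#> H) G"
    by (rule iso.normal_set_mult_subgroup)
  have MHM: "normal_in M (M <#> H)"
    using normal_in_between[OF assms(1) MH subgroup.subset[OF MH]] iso.H_contained_in_set_mult by blast
  have H: "normal_in (M \<inter> H) H"
    using normal_in_restrict[OF assms(1,2) subgroup.subset[OF assms(2)]] by (simp add: Int_commute)
  have "order (G\<lparr>carrier := H\<rparr> Mod (M \<inter> H)) = order (G\<lparr>carrier := M <#> H\<rparr> Mod M)"
    using iso.normal_intersection_quotient_isom by (rule iso_same_order)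
  then show "card H * card M = card (M <#> H) * card (M \<inter> H)"
    unfolding section_quotient(8)[OF MHM, symmetric] section_quotient(8)[OF H, symmetric]
    by simp
qed

text \<open>The index of \<open>(H \<inter> M) N\<close> in \<open>M\<close> divides both the order of
\<open>M/N\<close>, a power of \<open>x\<close>, and the index of \<open>H\<close> in \<open>G\<close>,
a power of \<open>r\<close>.\<close>

lemma covers_section:
  assumes "subgroup H G" "order G = card H * r ^ k"
    and "Factorial_Ring.prime r" "Factorial_Ring.prime x" "x \<noteq> r"
    and "normal_in N (carrier G)" "normal_in M (carrier G)" "N \<subseteq> M" "powers_in (x ^ e) M N"
  shows "M = (H \<inter> M) <#> N"
proof -
  note n = normal_inD[OF assms(6)] and m = normal_inD[OF assms(7)]
  let ?J = "(H \<inter> M) <#> N"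
  have HM: "subgroup (H \<inter> M) G"
    using assms(1) m(2) subgroups_Inter_pair by blast
  have NM: "normal_in N M"
    using normal_in_between[OF assms(6) m(2,3) assms(8)] .
  note J = set_mult_subgroup_normal_in[OF HM _ NM]
  have J': "subgroup ?J G" "H \<inter> M \<subseteq> ?J" "N \<subseteq> ?J" "?J \<subseteq> M"
    using J by auto
  obtain c where c: "card M = card ?J * c"
    using card_subgroup_dvd[OF J'(1) m(2) J'(4)] by blast
  obtain b where b: "card M = card N * x ^ b"
    using index_prime_power[OF NM assms(9,4)] .
  have "card ?J * c dvd card ?J * x ^ b"
    using c b card_subgroup_dvd[OF n(2) J'(1,3)] by (metis mult_dvd_mono dvd_refl)
  then have cx: "c dvd x ^ b"
    using card_subgroup_pos[OF J'(1)] by simp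
  have "card H * card M dvd order G * card (M \<inter> H)"
    unfolding product_formula(1)[OF assms(7,1)]
    using card_subgroup_dvd_order[OF product_formula(2)[OF assms(7,1)]] by (rule mult_dvd_mono) simp
  then have "card M dvd r ^ k * card (M \<inter> H)"
    unfolding assms(2) using card_subgroup_pos[OF assms(1)] by (simp add: mult.assoc)
  also have "\<dots> dvd r ^ k * card ?J"
    using card_subgroup_dvd[OF HM J'(1,2)] by (simp add: Int_commute)
  finally have "c dvd r ^ k"
    using c card_subgroup_pos[OF J'(1)] by (simp add: mult.commute)
  moreover have "coprime (x ^ b) (r ^ k)"
    using primes_coprime[OF assms(4,3,5)] by simp
  ultimately have "c = 1"
    using cx coprime_common_divisor_nat by blast
  then show ?thesis
    using subgroup_eqI[OF J'(1) m(2) J'(4)] c by simp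
qed

text \<open>The index of \<open>N\<close> in \<open>G\<close> divides the product of the index of \<open>H \<inter>
N\<close> in \<open>H\<close> and a power of \<open>r\<close>, so it is not divisible by
\<open>x\<close>.\<close>

lemma powers_in_pcopart_lift:
  assumes "subgroup H G" "order G = card H * r ^ k"
    and "Factorial_Ring.prime r" "Factorial_Ring.prime x" "x \<noteq> r"
    and "normal_in N (carrier G)" "powers_in (pcopart x) H (H \<inter> N)"
  shows "powers_in (pcopart x) (carrier G) N"
proof -
  note n = normal_inD[OF assms(6)]
  have HN: "normal_in (H \<inter> N) H"
    using normal_in_restrict[OF assms(6,1) subgroup.subset[OF assms(1)]] .
  note hn = normal_inD[OF HN]
  obtain c where c: "card H = card (H \<inter> N) * c"
    using card_subgroup_dvd[OF hn(2,1,3)] by blast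
  have "card H div card (H \<inter> N) = c"
    using c card_subgroup_pos[OF hn(2)] by simp
  then have xc: "\<not> x dvd c"
    using prime_dvd_exponent[OF HN assms(7,4)] not_dvd_pcopart[OF assms(4)] by auto
  obtain d where d: "card N = card (H \<inter> N) * d"
    using card_subgroup_dvd[OF hn(2) n(2)] by blast
  define i where "i = order G div card N"
  have i: "order G = card N * i"
    unfolding i_def using card_subgroup_dvd_order[OF n(2)] by simp
  have "card (H \<inter> N) * (c * r ^ k) = card (H \<inter> N) * (d * i)"
    using i assms(2) c d by (metis mult.assoc)
  then have "c * r ^ k = d * i"
    using card_subgroup_pos[OF hn(2)] by simp
  moreover have "\<not> x dvd c * r ^ k"
    using xc assms(3-5) by (metis prime_dvd_mult_nat prime_dvd_power primes_dvd_imp_eq)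
  ultimately have "\<not> x dvd i"
    by auto
  then have "coprime i (ppart x)"
    using prime_imp_coprime[OF assms(4)] unfolding ppart_def
    by (metis coprime_commute coprime_power_right_iff)
  moreover have "i dvd ppart x * pcopart x"
    unfolding ppart_pcopart using i by simp
  ultimately have "i dvd pcopart x"
    by (simp add: coprime_dvd_mult_right_iff)
  then obtain j where j: "pcopart x = i * j"
    by blast
  have "powers_in i (carrier G) N"
    using powers_in_index[OF assms(6)] unfolding i_def order_def .
  then show ?thesis
    unfolding powers_in_def j
    using subgroup_pow_closed[OF n(2)] by (simp flip: nat_pow_pow)
qed

lemma comm_mult_right:
  assumes "a \<in> carrier G" "b \<in> carrier G" "c \<in> carrier G"
  shows "comm a (b \<otimes> c) = comm a b \<otimes> (b \<otimes> comm a c \<otimes> inv b)"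
  using assms by (simp add: comm_def m_assoc inv_mult_group)

text \<open>A normal \<open>x'\<close>-subgroup of \<open>H\<close> lies in \<open>M =
O\<^bsub>x'x\<^esub>(G)\<close>, here relative to \<open>N\<close>. Write \<open>K =
O\<^bsub>x'\<^esub>(G)\<close>. The groups \<open>A\<close> and \<open>H \<inter> M\<close> normalize
each other, and \<open>A \<inter> M \<le> K\<close>, since \<open>M/K\<close> is an
\<open>x\<close>-group. Hence \<open>A\<close> centralizes \<open>H \<inter> M\<close> modulo
\<open>K\<close>, and then all of \<open>M\<close>, because \<open>M = (H \<inter> M) K\<close>. The
centralizer of \<open>M/K\<close> is contained in \<open>M\<close>.\<close>

lemma subset_radical_tower:
  assumes solv: "(derived G ^^ n) (carrier G) = {\<one>}"
    and H: "subgroup H G" "order G = card H * r ^ k"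
    and pr: "Factorial_Ring.prime r" "Factorial_Ring.prime x" "x \<noteq> r"
    and N: "normal_in N (carrier G)"
    and A: "normal_in A H" "powers_in (pcopart x) A N"
  defines "K \<equiv> radical (pcopart x) (carrier G) N"
  defines "M \<equiv> radical (ppart x) (carrier G) K"
  shows "A \<subseteq> M"
proof -
  note a = normal_inD[OF A(1)]
  have K: "normal_in K (carrier G)"
    unfolding K_def using normal_in_radical[OF unitary_pcopart[OF pr(2)] N] .
  have M: "normal_in M (carrier G)"
    unfolding M_def using normal_in_radical[OF unitary_ppart[OF pr(2)] K] .
  note kn = normal_inD[OF K] and mn = normal_inD[OF M]
  have NK: "N \<subseteq> K" and KM: "K \<subseteq> M"
    unfolding K_def M_def using subset_radical N K[unfolded K_def] by auto
  have MK: "powers_in (ppart x) M K"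
    unfolding M_def by (rule powers_in_radical)
  have cover: "M = (H \<inter> M) <#> K"
    using covers_section[OF H pr K M KM MK[unfolded ppart_def]] .
  have AM: "A \<inter> M \<subseteq> K"
  proof
    fix g assume g: "g \<in> A \<inter> M"
    then have "g [^] ppart x \<in> K" "g [^] pcopart x \<in> K"
      using MK A(2) NK by (auto simp: powers_in_def)
    then show "g \<in> K"
      using coprime_pow_mem[OF kn(2) _ _ _ coprime_ppart_pcopart[OF pr(2)]] g mn(3) by blast
  qed
  have "A \<subseteq> centralizer_mod (carrier G) M K"
  proof
    fix g assume g: "g \<in> A"
    then have gH: "g \<in> H" and gc: "g \<in> carrier G"
      using a(3) subgroup.mem_carrier[OF a(2)] by auto
    have "comm g y \<in> K" if yM: "y \<in> M" for y
    proof -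
      obtain h m where y: "h \<in> H \<inter> M" "m \<in> K" "y = h \<otimes> m"
        using yM cover mem_set_mult[of y "H \<inter> M" K] by blast
      have "comm g h \<in> A" "comm g h \<in> M"
        using comm_in_left[OF A(1) g] comm_in_right[OF M _ gc] y by auto
      then have "comm g h \<in> K"
        using AM by blast
      moreover have hc: "h \<in> carrier G" "m \<in> carrier G"
        using y mn(3) kn(3) by auto
      moreover have "comm g m \<in> K"
        using comm_in_right[OF K y(2) gc] .
      ultimately show ?thesis
        using kn(4) subgroup.m_closed[OF kn(2)] y gc by (simp add: comm_mult_right)
    qed
    then show "g \<in> centralizer_mod (carrier G) M K"
      using gc by (simp add: centralizer_mod_def)
  qed
  also have "\<dots> \<subseteq> M"
  proof (rule centralizer_mod_subset[OF solv ppart_pcopart coprime_ppart_pcopart[OF pr(2)] K M KM MK])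
    show "F \<subseteq> K" if "normal_in F (carrier G)" "K \<subseteq> F" "powers_in (pcopart x) F K" for F
      using radical_closed[OF unitary_pcopart[OF pr(2)] N] that unfolding K_def by blast
    show "F \<subseteq> M" if "normal_in F (carrier G)" "M \<subseteq> F" "powers_in (ppart x) F M" for F
      using radical_closed[OF unitary_ppart[OF pr(2)] K] that unfolding M_def by blast
  qed
  finally show ?thesis .
qed

text \<open>Induction along the word. If the bottom letter \<open>x\<close> disappears in the shortened word,
because it is \<open>r\<close> or is merged with the next letter, then \<open>H\<close> omits the
shortened form of the remaining word and so does \<open>G\<close>, and prefixing a letter preserves
omission. If \<open>H\<close> is an \<open>x'\<close>-group modulo \<open>N\<close>, then so is
\<open>G\<close>, as the index of \<open>H\<close> is a power of \<open>r \<noteq> x\<close>. Otherwise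
let \<open>A \<le> B\<close> be the first two terms of the series of \<open>H\<close>, and \<open>M =
O\<^bsub>x'x\<^esub>(G)\<close>. By \<open>subset_radical_tower\<close>, \<open>A \<le> M\<close>, so
\<open>B\<close> is an \<open>x\<close>-group modulo \<open>H \<inter> M\<close>. The next letter
\<open>y\<close> of the shortened word differs from \<open>x\<close>, so this \<open>x\<close>-group is
absorbed by the \<open>y'\<close>-group above it, and the induction hypothesis applies to
\<open>M\<close>.\<close>

theorem omits_lift:
  assumes solv: "(derived G ^^ n) (carrier G) = {\<one>}"
    and H: "subgroup H G" "order G = card H * r ^ k" and r: "Factorial_Ring.prime r"
    and "\<forall>x\<in>set w. Factorial_Ring.prime x"
    and "normal_in N (carrier G)" "omits (delete_letter r w) H (H \<inter> N)"
  shows "omits w (carrier G) N"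
  using assms(5-7)
proof (induction w arbitrary: N)
  case Nil
  then show ?case
    by (simp add: delete_letter_def)
next
  case (Cons x u)
  note N = Cons.prems(2)
  have x: "Factorial_Ring.prime x" and u: "\<forall>y\<in>set u. Factorial_Ring.prime y"
    using Cons.prems(1) by auto
  have easy: "omits (x # u) (carrier G) N" if "omits (delete_letter r u) H (H \<inter> N)"
  proof -
    have "omits u (carrier G) N"
      using Cons.IH[OF u N that] .
    then show ?thesis
      using N powers_in_self[OF normal_inD(2)[OF N]] by auto
  qed
  \<comment> \<open>Either \<open>x\<close> is deleted, or it is the only letter left, or some letter \<open>y\<close> follows it.\<close>
  consider "x = r" | "x \<noteq> r" "filter (\<lambda>y. y \<noteq> r) u = []"
    | y v where "x \<noteq> r" "filter (\<lambda>y. y \<noteq> r) u = y # v"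
    by (cases "filter (\<lambda>y. y \<noteq> r) u") auto
  then show ?case
  proof cases
    case 1
    then show ?thesis
      using easy Cons.prems(3) by (simp add: delete_letter_def)
  next
    case 2
    then have "powers_in (pcopart x) H (H \<inter> N)"
      using Cons.prems(3) by (simp add: delete_letter_def)
    then show ?thesis
      using powers_in_pcopart_lift[OF H r x \<open>x \<noteq> r\<close> N] N by simp
  next
    case (3 y v)
    show ?thesis
    proof (cases "x = y")
      case True
      then show ?thesis
        using easy Cons.prems(3) 3 by (simp add: delete_letter_def)
    next
      case False
      obtain v' where v': "delete_letter r u = y # v'"
        unfolding delete_letter_def 3(2) by (metis remdups_adj_Cons_alt)
      have del: "delete_letter r (x # u) = x # y # v'"
        using 3 False v' by (simp add: delete_letter_def)
      have y: "Factorial_Ring.prime y"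
      proof -
        have "y \<in> set (filter (\<lambda>y. y \<noteq> r) u)"
          unfolding 3(2) by simp
        then show ?thesis
          using u by auto
      qed
      consider "powers_in (pcopart x) H (H \<inter> N)"
        | A B where "normal_in A H" "normal_in B H" "H \<inter> N \<subseteq> A" "A \<subseteq> B"
            "powers_in (pcopart x) A (H \<inter> N)" "powers_in (ppart x) B A" "omits (y # v') H B"
        using Cons.prems(3) unfolding del by (subst (asm) omits.simps) blast
      then show ?thesis
      proof cases
        case 1
        then show ?thesis
          using powers_in_pcopart_lift[OF H r x \<open>x \<noteq> r\<close> N] N by simp
      next
        case (2 A B)
        define K where "K = radical (pcopart x) (carrier G) N"
        define M where "M = radical (ppart x) (carrier G) K"
        have K: "normal_in K (carrier G)"
          unfolding K_def using normal_in_radical[OF unitary_pcopart[OF x] N] .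
        have M: "normal_in M (carrier G)"
          unfolding M_def using normal_in_radical[OF unitary_ppart[OF x] K] .
        have NK: "N \<subseteq> K" and KM: "K \<subseteq> M"
          unfolding K_def M_def using subset_radical N K[unfolded K_def] by auto
        have AM: "A \<subseteq> M"
          unfolding M_def K_def
          using subset_radical_tower[OF solv H r x \<open>x \<noteq> r\<close> N 2(1) powers_in_mono[OF 2(5)]] by blast
        have HM: "normal_in (H \<inter> M) H"
          using normal_in_restrict[OF M H(1) subgroup.subset[OF H(1)]] .
        note b = normal_inD[OF 2(2)]
        note bm = set_mult_subgroup_normal_in[OF b(2,3) HM]
        have B: "omits (y # v') H (B <#> (H \<inter> M))"
          using omits_mono[OF 2(7) bm(2) normal_in_set_mult[OF 2(2) HM]] .
        have "A \<subseteq> H \<inter> M"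
          using AM normal_inD(3)[OF 2(1)] by blast
        then have "powers_in (ppart x) (B <#> (H \<inter> M)) (H \<inter> M)"
          using powers_in_mult[OF HM b(3) powers_in_mono[OF 2(6) subset_refl]] by blast
        then have "omits (y # v') H (H \<inter> M)"
          using omits_absorb[OF B HM bm(3) _ x y False] by blast
        then have "omits u (carrier G) M"
          using Cons.IH[OF u M] v' by simp
        moreover have "powers_in (pcopart x) K N" "powers_in (ppart x) M K"
          unfolding K_def M_def by (rule powers_in_radical)+
        ultimately show ?thesis
          using N K M NK KM by auto
      qed
    qed
  qed
qed

section \<open>Nilpotent sections\<close>

text \<open>The preimages in \<open>H\<close> of the terms of the upper central series of \<open>H/N\<close>.
Compared with the lower central series this has two advantages: it is described without generators, and
intersections of sections are easy to handle (\<open>upper_central_Int\<close>).\<close>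

definition upper_central :: "'a set \<Rightarrow> nat \<Rightarrow> 'a set \<Rightarrow> 'a set"
  where "upper_central H n N = ((\<lambda>Z. centralizer_mod H H Z) ^^ n) N"

lemma upper_central_0 [simp]: "upper_central H 0 N = N"
  by (simp add: upper_central_def)

lemma upper_central_Suc: "upper_central H (Suc n) N = centralizer_mod H H (upper_central H n N)"
  by (simp add: upper_central_def)

lemma upper_central_Suc2: "upper_central H (Suc n) N = upper_central H n (centralizer_mod H H N)"
  by (simp add: upper_central_def funpow_swap1)

lemma centralizer_mod_mono: "Z \<subseteq> Z' \<Longrightarrow> centralizer_mod H M Z \<subseteq> centralizer_mod H M Z'"
  by (auto simp: centralizer_mod_def)

lemma subset_centralizer_mod:
  assumes "normal_in Z H"
  shows "Z \<subseteq> centralizer_mod H H Z"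
  using comm_in_left[OF assms] normal_inD(3)[OF assms] by (auto simp: centralizer_mod_def)

lemma normal_in_upper_central:
  assumes "normal_in N H"
  shows "normal_in (upper_central H n N) H"
  using assms
  by (induction n)
    (auto simp: upper_central_Suc intro!: normal_in_centralizer_mod normal_in_refl dest: normal_inD(1))

lemma upper_central_mono: "N \<subseteq> N' \<Longrightarrow> upper_central H n N \<subseteq> upper_central H n N'"
  by (induction n) (auto simp: upper_central_Suc dest: centralizer_mod_mono)

lemma upper_central_increasing:
  assumes "normal_in N H" "m \<le> n"
  shows "upper_central H m N \<subseteq> upper_central H n N"
  using assms(2)
proof (induction n rule: dec_induct)
  case (step n)
  then show ?case
    using subset_centralizer_mod[OF normal_in_upper_central[OF assms(1), of n]]
    by (auto simp: upper_central_Suc)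
qed simp

lemma upper_central_Int:
  "upper_central M k N \<inter> upper_central M' k N' \<subseteq> upper_central (M \<inter> M') k (N \<inter> N')"
  by (induction k) (auto simp: upper_central_Suc centralizer_mod_def)

definition nilpotent_section :: "'a set \<Rightarrow> 'a set \<Rightarrow> bool"
  where "nilpotent_section H N \<longleftrightarrow> normal_in N H \<and> (\<exists>n. upper_central H n N = H)"

lemma section_comm:
  assumes "normal_in N H" "a \<in> H" "b \<in> H"
  defines "Q \<equiv> G\<lparr>carrier := H\<rparr> Mod N"
  shows "(N #> a) \<otimes>\<^bsub>Q\<^esub> (N #> b) \<otimes>\<^bsub>Q\<^esub> inv\<^bsub>Q\<^esub> (N #> a) \<otimes>\<^bsub>Q\<^esub> inv\<^bsub>Q\<^esub> (N #> b) = N #> comm a b"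
proof -
  note q = section_quotient[OF assms(1), folded Q_def] and h = normal_inD(1)[OF assms(1)]
  show ?thesis
    using assms(2,3) subgroup.m_closed[OF h] subgroup.m_inv_closed[OF h]
    unfolding comm_def by (simp add: q(3,4) del: mult_FactGroup)
qed

text \<open>Both central series of a nilpotent group descend in step: the commutator of an element of the
\<open>(i+1)\<close>-st upper term with any element lies in the \<open>i\<close>-th.\<close>

lemma lower_central_section_subset:
  assumes "normal_in N H" "upper_central H n N = H" "i \<le> n"
  defines "Q \<equiv> G\<lparr>carrier := H\<rparr> Mod N"
  shows "lower_central Q i \<subseteq> (\<lambda>h. N #> h) ` upper_central H (n - i) N"
  using assms(3)
proof (induction i)
  case 0
  show ?case
    using section_quotient(2)[OF assms(1)] assms(2) unfolding Q_def by (simp add: lower_central_def)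
next
  case (Suc i)
  note q = section_quotient[OF assms(1), folded Q_def] and h = normal_inD(1)[OF assms(1)]
  interpret Q: group Q
    by (rule q)
  define W where "W = upper_central H (n - Suc i) N"
  have "normal_in W H"
    unfolding W_def using assms(1) by (rule normal_in_upper_central)
  note w = normal_inD[OF this]
  have sub: "subgroup ((\<lambda>h. N #> h) ` W) Q"
  proof (rule Q.subgroupI)
    show "(\<lambda>h. N #> h) ` W \<subseteq> carrier Q" "(\<lambda>h. N #> h) ` W \<noteq> {}"
      using q(2) w(3) subgroup.one_closed[OF w(2)] by auto
  next
    fix a assume "a \<in> (\<lambda>h. N #> h) ` W"
    then show "inv\<^bsub>Q\<^esub> a \<in> (\<lambda>h. N #> h) ` W"
      using q(4) w(3) subgroup.m_inv_closed[OF w(2)] by auto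
  next
    fix a b assume "a \<in> (\<lambda>h. N #> h) ` W" "b \<in> (\<lambda>h. N #> h) ` W"
    then obtain c d where "c \<in> W" "a = N #> c" "d \<in> W" "b = N #> d"
      by blast
    then show "a \<otimes>\<^bsub>Q\<^esub> b \<in> (\<lambda>h. N #> h) ` W"
      using q(3)[of c d] w(3) subgroup.m_closed[OF w(2), of c d] by auto
  qed
  have Z: "upper_central H (n - i) N = centralizer_mod H H W"
    using Suc.prems upper_central_Suc[of H "n - Suc i" N] unfolding W_def
    by (metis Suc_diff_Suc Suc_le_lessD)
  have "lower_central Q (Suc i) = commutator_subgroup Q (lower_central Q i) (carrier Q)"
    by (simp add: lower_central_def)
  also have "\<dots> \<subseteq> (\<lambda>h. N #> h) ` W"
    unfolding commutator_subgroup_def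
  proof (rule Q.generate_subgroup_incl[OF _ sub], clarify)
    fix a b assume a: "a \<in> lower_central Q i" and b: "b \<in> carrier Q"
    obtain c where c: "c \<in> centralizer_mod H H W" "a = N #> c"
      using a Suc Z by auto
    obtain d where d: "d \<in> H" "b = N #> d"
      using b q(2) by auto
    have "c \<in> H" "comm c d \<in> W"
      using c d by (auto simp: centralizer_mod_def)
    then show "a \<otimes>\<^bsub>Q\<^esub> b \<otimes>\<^bsub>Q\<^esub> inv\<^bsub>Q\<^esub> a \<otimes>\<^bsub>Q\<^esub> inv\<^bsub>Q\<^esub> b \<in> (\<lambda>h. N #> h) ` W"
      using section_comm[OF assms(1) \<open>c \<in> H\<close> d(1)] c(2) d(2) unfolding Q_def by auto
  qed
  finally show ?case
    unfolding W_def .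
qed

text \<open>The converse comparison, read upwards from the trivial last term of the lower central series.\<close>

lemma lower_central_section_preimage:
  assumes "normal_in N H" "i \<le> n"
  defines "Q \<equiv> G\<lparr>carrier := H\<rparr> Mod N"
  assumes "lower_central Q n = {\<one>\<^bsub>Q\<^esub>}"
    and "h \<in> H" "N #> h \<in> lower_central Q (n - i)"
  shows "h \<in> upper_central H i N"
  using assms(2,5,6)
proof (induction i arbitrary: h)
  case 0
  then show ?case
    using section_quotient(6,7)[OF assms(1)] assms(4) unfolding Q_def by auto
next
  case (Suc i)
  note q = section_quotient[OF assms(1), folded Q_def] and H = normal_inD(1)[OF assms(1)]
  have "comm h y \<in> upper_central H i N" if y: "y \<in> H" for y
  proof (rule Suc.IH)
    show "comm h y \<in> H"
      unfolding comm_def using Suc.prems(2) y H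
      by (simp add: subgroup.m_closed subgroup.m_inv_closed)
    have "N #> y \<in> carrier Q"
      using y q(2) by blast
    then have "N #> comm h y \<in> commutator_subgroup Q (lower_central Q (n - Suc i)) (carrier Q)"
      using section_comm[OF assms(1) Suc.prems(2) y, folded Q_def] Suc.prems(3)
      unfolding commutator_subgroup_def by (intro generate.incl) blast
    also have "\<dots> = lower_central Q (n - i)"
      using Suc.prems(1) by (simp add: lower_central_def flip: Suc_diff_Suc)
    finally show "N #> comm h y \<in> lower_central Q (n - i)" .
  qed (use Suc.prems in simp)
  then show ?case
    using Suc.prems(2) by (simp add: upper_central_Suc centralizer_mod_def)
qed

lemma nilpotent_section_iff:
  assumes "normal_in N H"
  shows "nilpotent_section H N \<longleftrightarrow> nilpotent_group (G\<lparr>carrier := H\<rparr> Mod N)"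
proof -
  let ?Q = "G\<lparr>carrier := H\<rparr> Mod N"
  note q = section_quotient[OF assms] and n = normal_inD[OF assms]
  interpret Q: group ?Q
    by (rule q)
  show ?thesis
  proof
    assume "nilpotent_section H N"
    then obtain k where k: "upper_central H k N = H"
      unfolding nilpotent_section_def by blast
    have "lower_central ?Q k \<subseteq> (\<lambda>h. N #> h) ` N"
      using lower_central_section_subset[OF assms k, of k] by simp
    also have "\<dots> \<subseteq> {\<one>\<^bsub>?Q\<^esub>}"
      using q(6,7) n(3) by auto
    finally have "lower_central ?Q k \<subseteq> {\<one>\<^bsub>?Q\<^esub>}" .
    moreover have "\<one>\<^bsub>?Q\<^esub> \<in> lower_central ?Q k"
      by (cases k) (auto simp: lower_central_def commutator_subgroup_def simp del: one_FactGroup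
          intro: generate.one)
    ultimately show "nilpotent_group ?Q"
      unfolding nilpotent_group_def by blast
  next
    assume "nilpotent_group ?Q"
    then obtain k where k: "lower_central ?Q k = {\<one>\<^bsub>?Q\<^esub>}"
      unfolding nilpotent_group_def by blast
    have "H \<subseteq> upper_central H k N"
    proof
      fix h assume h: "h \<in> H"
      then have "N #> h \<in> lower_central ?Q (k - k)"
        using q(2) by (simp add: lower_central_def)
      then show "h \<in> upper_central H k N"
        using lower_central_section_preimage[OF assms _ k h] by blast
    qed
    then show "nilpotent_section H N"
      using assms normal_inD(3)[OF normal_in_upper_central[OF assms, of k]]
      unfolding nilpotent_section_def by blast
  qed
qed

lemma nilpotent_section_refl: "subgroup H G \<Longrightarrow> nilpotent_section H H"
  unfolding nilpotent_section_def using normal_in_refl upper_central_0 by blast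

text \<open>The quotient \<open>(M \<inter> M') / (N \<inter> N')\<close> embeds into \<open>M/N \<times> M'/N'\<close>.\<close>

lemma nilpotent_section_Int:
  assumes "nilpotent_section M N" "nilpotent_section M' N'"
    and "normal_in (N \<inter> N') (M \<inter> M')"
  shows "nilpotent_section (M \<inter> M') (N \<inter> N')"
proof -
  obtain k k' where k: "upper_central M k N = M" "upper_central M' k' N' = M'"
    using assms unfolding nilpotent_section_def by blast
  have n: "normal_in N M" "normal_in N' M'"
    using assms unfolding nilpotent_section_def by auto
  let ?m = "max k k'"
  have "M \<subseteq> upper_central M ?m N" "M' \<subseteq> upper_central M' ?m N'"
    using upper_central_increasing[OF n(1), of k ?m] upper_central_increasing[OF n(2), of k' ?m] k
    by auto
  then have "M \<inter> M' \<subseteq> upper_central (M \<inter> M') ?m (N \<inter> N')"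
    using upper_central_Int[of M ?m N M' N'] by blast
  then show ?thesis
    using assms(3) normal_inD(3)[OF normal_in_upper_central[OF assms(3), of ?m]]
    unfolding nilpotent_section_def by blast
qed

text \<open>As long as the upper central series has not reached \<open>H\<close>, the quotient by its current term is a
nontrivial \<open>x\<close>-group and so has a nontrivial center.\<close>

lemma p_section_nilpotent:
  assumes "normal_in N H" "powers_in (x ^ a) H N" "Factorial_Ring.prime x"
  shows "nilpotent_section H N"
  using assms
proof (induction "card H - card N" arbitrary: N rule: less_induct)
  case less
  note n = normal_inD[OF less.prems(1)]
  show ?case
  proof (cases "N = H")
    case True
    then show ?thesis
      using nilpotent_section_refl[OF n(1)] by simp
  next
    case False
    let ?Z = "centralizer_mod H H N"
    have Z: "normal_in ?Z H"
      using normal_in_upper_central[OF less.prems(1), of 1] by (simp add: upper_central_Suc)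
    have sub: "N \<subseteq> ?Z"
      using subset_centralizer_mod[OF less.prems(1)] .
    obtain h where "h \<in> ?Z" "h \<notin> N"
      using p_section_center[OF less.prems False] by (auto simp: centralizer_mod_def)
    then have "card N < card ?Z"
      using psubset_card_mono[of ?Z N] finite_subgroup[OF normal_inD(2)[OF Z]] sub by blast
    moreover have "card ?Z \<le> card H"
      using card_mono[OF finite_subgroup[OF n(1)] normal_inD(3)[OF Z]] .
    ultimately have "nilpotent_section H ?Z"
      using less.hyps[OF _ Z powers_in_mono[OF less.prems(2) subset_refl sub] assms(3)] by simp
    then obtain k where "upper_central H (Suc k) N = H"
      unfolding nilpotent_section_def upper_central_Suc2 by blast
    then show ?thesis
      unfolding nilpotent_section_def using less.prems(1) by blast
  qed
qed

text \<open>Suppose that \<open>H/A\<close> has no nontrivial normal \<open>p'\<close>-subgroup. Then the center of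
\<open>H/A\<close> is a \<open>p\<close>-group, and the exponent of each upper central factor divides
that of the one below, since modulo lower terms the commutator with a fixed element is a homomorphism.\<close>

lemma upper_central_powers:
  assumes "Factorial_Ring.prime p" "normal_in A H"
    and closed: "\<And>F. normal_in F H \<Longrightarrow> A \<subseteq> F \<Longrightarrow> powers_in (pcopart p) F A \<Longrightarrow> F \<subseteq> A"
  shows "powers_in (ppart p) (upper_central H (Suc i) A) (upper_central H i A)"
proof (induction i)
  note a = normal_inD[OF assms(2)]
  case 0
  let ?Z = "centralizer_mod H H A"
  have Z: "normal_in ?Z H"
    using normal_in_upper_central[OF assms(2), of 1] by (simp add: upper_central_Suc)
  note z = normal_inD[OF Z]
  have AZ: "A \<subseteq> ?Z"
    using subset_centralizer_mod[OF assms(2)] .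
  \<comment> \<open>The \<open>p'\<close>-part of the center of \<open>H/A\<close>.\<close>
  define F where "F = {g \<in> ?Z. g [^] pcopart p \<in> A}"
  have "normal_in F H"
    unfolding F_def
  proof (rule normal_in_power_kernel[OF Z assms(2) AZ])
    fix a b assume "a \<in> ?Z" "b \<in> ?Z"
    then show "comm a b \<in> A"
      using z(3) by (auto simp: centralizer_mod_def)
  qed
  then have FA: "F \<subseteq> A"
    using closed[of F] AZ subgroup_pow_closed[OF a(2)] by (auto simp: F_def powers_in_def)
  show ?case
    unfolding powers_in_def
  proof
    fix g assume "g \<in> upper_central H (Suc 0) A"
    then have g: "g \<in> ?Z" and gc: "g \<in> carrier G"
      using z(2) by (auto simp: upper_central_Suc subgroup.mem_carrier)
    have "(g [^] ppart p) [^] pcopart p \<in> A"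
      using pow_order_eq_1[OF gc] gc subgroup.one_closed[OF a(2)]
      by (simp add: nat_pow_pow ppart_pcopart)
    then show "g [^] ppart p \<in> upper_central H 0 A"
      using FA subgroup_pow_closed[OF z(2) g] by (auto simp: F_def)
  qed
next
  case (Suc i)
  let ?Z = "\<lambda>i. upper_central H i A"
  have nz: "normal_in (?Z i) H" for i
    using assms(2) by (rule normal_in_upper_central)
  note h = normal_inD(1)[OF assms(2)] and z = normal_inD[OF nz]
  show ?case
    unfolding powers_in_def
  proof
    fix g assume g: "g \<in> ?Z (Suc (Suc i))"
    have gH: "g \<in> H"
      using g z(3) by blast
    have "comm (g [^] ppart p) y \<in> ?Z i" if y: "y \<in> H" for y
    proof -
      have c: "comm g y \<in> ?Z (Suc i)"
        using g y by (simp add: upper_central_Suc centralizer_mod_def)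
      then have "comm (comm g y) g \<in> ?Z i"
        using gH by (simp add: upper_central_Suc centralizer_mod_def)
      moreover have "comm g y \<in> carrier G" "g \<in> carrier G"
        using subgroup.mem_carrier[OF z(2) c] subgroup.mem_carrier[OF h gH] .
      ultimately have "comm g (comm g y) \<in> ?Z i"
        using subgroup.m_inv_closed[OF z(2)] inv_comm by metis
      then obtain l where l: "l \<in> ?Z i" "comm (g [^] ppart p) y = l \<otimes> comm g y [^] ppart p"
        using comm_pow_normal_in[OF nz gH y] by blast
      moreover have "comm g y [^] ppart p \<in> ?Z i"
        using Suc c by (simp add: powers_in_def)
      ultimately show ?thesis
        using subgroup.m_closed[OF z(2)] by simp
    qed
    then show "g [^] ppart p \<in> ?Z (Suc i)"
      using subgroup_pow_closed[OF h gH] by (simp add: upper_central_Suc centralizer_mod_def)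
  qed
qed

text \<open>A nilpotent group is a \<open>p\<close>-group modulo its largest normal \<open>p'\<close>-subgroup: the
upper central series above the latter has \<open>p\<close>-groups as factors and reaches
\<open>H\<close>.\<close>

lemma nilpotent_section_p_part:
  assumes "nilpotent_section H N" "Factorial_Ring.prime p"
  shows "powers_in (ppart p) H (radical (pcopart p) H N)"
proof -
  have N: "normal_in N H"
    using assms(1) unfolding nilpotent_section_def by blast
  let ?A = "radical (pcopart p) H N"
  have A: "normal_in ?A H"
    using normal_in_radical[OF unitary_pcopart[OF assms(2)] N] .
  obtain k where k: "upper_central H k N = H"
    using assms(1) unfolding nilpotent_section_def by blast
  have step: "powers_in (ppart p) (upper_central H (Suc i) ?A) (upper_central H i ?A)" for i
    using upper_central_powers[OF assms(2) A] radical_closed[OF unitary_pcopart[OF assms(2)] N] by blast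
  have "powers_in (ppart p) (upper_central H i ?A) ?A" for i
  proof (induction i)
    case 0
    show ?case
      using powers_in_self[OF normal_inD(2)[OF A]] by simp
  next
    case (Suc i)
    show ?case
      using powers_in_trans[OF unitary_ppart[OF assms(2)] _ normal_inD(2)[OF A] step Suc]
        normal_inD(2)[OF normal_in_upper_central[OF A]] by blast
  qed
  moreover have "H \<subseteq> upper_central H k ?A"
    using upper_central_mono[OF subset_radical[OF N]] k by blast
  ultimately show ?thesis
    unfolding powers_in_def by blast
qed

section \<open>Nilpotent series omit long words\<close>

text \<open>The series witnessing an omitted word can be replaced by the series of iterated radicals, which
grows fastest.\<close>

lemma omits_radical:
  assumes "omits (x # u) H N" "Factorial_Ring.prime x"
  shows "powers_in (pcopart x) H N \<or> omits u H (radical (ppart x) H (radical (pcopart x) H N))"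
proof -
  let ?K = "radical (pcopart x) H N"
  let ?M = "radical (ppart x) H ?K"
  have N: "normal_in N H"
    using assms(1) by simp
  have K: "normal_in ?K H"
    using normal_in_radical[OF unitary_pcopart[OF assms(2)] N] .
  have M: "normal_in ?M H"
    using normal_in_radical[OF unitary_ppart[OF assms(2)] K] .
  consider "powers_in (pcopart x) H N"
    | A B where "normal_in A H" "normal_in B H" "N \<subseteq> A" "A \<subseteq> B"
        "powers_in (pcopart x) A N" "powers_in (ppart x) B A" "omits u H B"
    using assms(1) by auto
  then show ?thesis
  proof cases
    case (2 A B)
    note b = normal_inD[OF 2(2)]
    note bk = set_mult_subgroup_normal_in[OF b(2,3) K]
    have "A \<subseteq> ?K"
      using radical_greatest 2 by blast
    then have "powers_in (ppart x) (B <#> ?K) ?K"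
      using powers_in_mult[OF K b(3) powers_in_mono[OF 2(6) subset_refl]] by blast
    then have "B \<subseteq> ?M"
      using radical_greatest[OF normal_in_set_mult[OF 2(2) K] bk(3)] bk(2) by blast
    then show ?thesis
      using omits_mono[OF 2(7) _ M] by blast
  qed blast
qed

text \<open>A nilpotent group on top adds room for one more letter. The radicals of \<open>K\<close> are normal in
\<open>L\<close>, so the canonical series of \<open>K\<close> is a normal series of \<open>L\<close>. If
\<open>y\<close> is the letter at which it ends with a \<open>y'\<close>-group, then this group and the
\<open>y'\<close>-part of \<open>L/K\<close> together form a \<open>y'\<close>-group, above which only a
\<open>y\<close>-group is left.\<close>

lemma omits_extend:
  assumes "omits w K N" "nilpotent_section L K" "normal_in N L" "\<forall>y\<in>set w. Factorial_Ring.prime y"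
  shows "omits (w @ [x]) L N"
  using assms
proof (induction w arbitrary: N)
  case (Cons y u)
  have KL: "normal_in K L"
    using Cons.prems(2) unfolding nilpotent_section_def by blast
  note l = normal_inD(1)[OF KL]
  have y: "Factorial_Ring.prime y"
    using Cons.prems(4) by simp
  have NK: "normal_in N K"
    using Cons.prems(1) by simp
  show ?case
    using omits_radical[OF Cons.prems(1) y]
  proof
    assume p: "powers_in (pcopart y) K N"
    let ?T = "radical (pcopart y) L K"
    have T: "normal_in ?T L"
      using normal_in_radical[OF unitary_pcopart[OF y] KL] .
    have "powers_in (pcopart y) ?T N"
      using powers_in_trans[OF unitary_pcopart[OF y] normal_inD(2)[OF T] normal_inD(2)[OF NK]
          powers_in_radical p] .
    moreover have "powers_in (ppart y) L ?T"
      using nilpotent_section_p_part[OF Cons.prems(2) y] .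
    moreover have "omits (u @ [x]) L L"
      using omits_self[OF l] by blast
    moreover have "N \<subseteq> ?T"
      using subset_radical[OF KL] normal_inD(3)[OF NK] by blast
    ultimately show ?thesis
      using T normal_inD(3)[OF T] normal_in_refl[OF l] Cons.prems(3) by auto
  next
    let ?A = "radical (pcopart y) K N"
    let ?B = "radical (ppart y) K ?A"
    assume o: "omits u K ?B"
    have AK: "normal_in ?A K"
      using normal_in_radical[OF unitary_pcopart[OF y] NK] .
    have A: "normal_in ?A L"
      using normal_in_radical_super[OF unitary_pcopart[OF y] NK KL Cons.prems(3)] .
    have B: "normal_in ?B L"
      using normal_in_radical_super[OF unitary_ppart[OF y] AK KL A] .
    have "omits (u @ [x]) L ?B"
      using Cons.IH[OF o Cons.prems(2) B] Cons.prems(4) by simp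
    then show ?thesis
      using A B subset_radical[OF NK] subset_radical[OF AK] powers_in_radical Cons.prems(3)
      by auto
  qed
qed simp

lemma nilpotent_series_omits:
  assumes "nilpotent_series G n H" "\<forall>y\<in>set w. Factorial_Ring.prime y" "n < length w"
  shows "omits w H {\<one>}"
  using assms
proof (induction arbitrary: w rule: nilpotent_series.induct)
  case unity
  then show ?case
    using omits_self[OF triv_subgroup] by auto
next
  case (extension n K H)
  obtain v x where w: "w = v @ [x]"
    using extension.prems(2) by (metis gr_implies_not0 length_0_conv rev_exhaust)
  have "normal_in K H"
    using extension.hyps normal_in_iff_normal by blast
  then have "nilpotent_section H K"
    using nilpotent_section_iff extension.hyps by blast
  moreover have "omits v K {\<one>}"
    using extension w by simp
  moreover have "normal_in {\<one>} H"
    using normal_in_one extension.hyps by blast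
  ultimately show ?case
    unfolding w using omits_extend extension.prems(1) w by simp
qed

section \<open>A word of critical length\<close>

text \<open>The analogue of \<open>nilpotent_series\<close> for the quotient of \<open>G\<close> by
\<open>N\<close>. It is built from the top and has terms that are normal in \<open>G\<close>.\<close>

fun nilpotent_chain :: "nat \<Rightarrow> 'a set \<Rightarrow> bool"
  where
    "nilpotent_chain 0 N \<longleftrightarrow> N = carrier G"
  | "nilpotent_chain (Suc n) N \<longleftrightarrow>
      (\<exists>M. normal_in M (carrier G) \<and> nilpotent_section M N \<and> nilpotent_chain n M)"

lemma normal_in_carrier: "normal_in (carrier G) (carrier G)"
  by (rule normal_in_refl[OF subgroup_self])

lemma nilpotent_chain_carrier: "nilpotent_chain n (carrier G)"
  by (induction n) (use normal_in_carrier nilpotent_section_refl[OF subgroup_self] in auto)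

lemma nilpotent_chain_series:
  assumes "nilpotent_chain n N" "nilpotent_series G j N" "subgroup N G"
  shows "nilpotent_series G (n + j) (carrier G)"
  using assms
proof (induction n arbitrary: j N)
  case (Suc n)
  obtain M where M: "normal_in M (carrier G)" "nilpotent_section M N" "nilpotent_chain n M"
    using Suc.prems(1) by auto
  have N: "normal_in N M"
    using M(2) by (simp add: nilpotent_section_def)
  note m = normal_inD(2)[OF M(1)]
  have "nilpotent_series G (Suc j) M"
  proof (rule nilpotent_series.extension[OF Suc.prems(2) _ m])
    show "N \<lhd> G\<lparr>carrier := M\<rparr>"
      using N normal_in_iff_normal[OF m] by blast
    show "nilpotent_group (G\<lparr>carrier := M\<rparr> Mod N)"
      using M(2) nilpotent_section_iff[OF N] by blast
  qed
  then show ?case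
    using Suc.IH[OF M(3) _ m] by fastforce
qed simp

text \<open>The groups of Fitting length at most \<open>n\<close> are closed under subdirect products.\<close>

lemma nilpotent_chain_Int:
  assumes "nilpotent_chain n N" "nilpotent_chain n N'" "normal_in N (carrier G)" "normal_in N' (carrier G)"
  shows "nilpotent_chain n (N \<inter> N')"
  using assms
proof (induction n arbitrary: N N')
  case (Suc n)
  obtain M where M: "normal_in M (carrier G)" "nilpotent_section M N" "nilpotent_chain n M"
    using Suc.prems(1) by auto
  obtain M' where M': "normal_in M' (carrier G)" "nilpotent_section M' N'" "nilpotent_chain n M'"
    using Suc.prems(2) by auto
  have MM: "normal_in (M \<inter> M') (carrier G)"
    using normal_in_Int M(1) M'(1) by blast
  have "N \<subseteq> M" "N' \<subseteq> M'"
    using M(2) M'(2) normal_inD(3) unfolding nilpotent_section_def by auto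
  then have "normal_in (N \<inter> N') (M \<inter> M')"
    using normal_in_between[OF normal_in_Int[OF Suc.prems(3,4)] normal_inD(2,3)[OF MM]] by blast
  then have "nilpotent_section (M \<inter> M') (N \<inter> N')"
    using nilpotent_section_Int[OF M(2) M'(2)] by blast
  then show ?case
    using Suc.IH[OF M(3) M'(3) M(1) M'(1)] MM by auto
qed simp

lemma finite_Inter_induct:
  assumes "finite S" "P T" "\<And>x. x \<in> S \<Longrightarrow> P (A x)" "\<And>U V. P U \<Longrightarrow> P V \<Longrightarrow> P (U \<inter> V)"
  shows "P (T \<inter> (\<Inter>x\<in>S. A x))"
  using assms(1,3)
proof (induction S rule: finite_induct)
  case (insert y S)
  have "P (A y \<inter> (T \<inter> (\<Inter>x\<in>S. A x)))"
    using insert assms(4) by simp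
  then show ?case
    by (simp add: Int_left_commute)
qed (use assms(2) in simp)

text \<open>By Cauchy's theorem the index of \<open>N\<close> in \<open>H\<close> is divisible by no prime other
than \<open>q\<close>.\<close>

lemma powers_in_ppart_from_others:
  assumes "normal_in N H"
    and "\<And>x. Factorial_Ring.prime x \<Longrightarrow> x dvd order G \<Longrightarrow> x \<noteq> q \<Longrightarrow> powers_in (pcopart x) H N"
  shows "powers_in (ppart q) H N"
proof -
  note n = normal_inD[OF assms(1)]
  define i where "i = card H div card N"
  have "card H = card N * i"
    unfolding i_def using card_subgroup_dvd[OF n(2,1,3)] by simp
  then have i: "i dvd order G"
    using card_subgroup_dvd_order[OF n(1)] by (metis dvd_mult_right)
  have only: "x = q" if "Factorial_Ring.prime x" "x dvd i" for x
    using prime_dvd_exponent[OF assms(1) assms(2) that(1)] not_dvd_pcopart[OF that(1)] that i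
    unfolding i_def by (meson dvd_trans)
  have "i dvd ppart q"
  proof (cases "i = 1")
    case False
    then have q: "Factorial_Ring.prime q" "q dvd i"
      using only prime_factor_nat by blast+
    have "coprime i (pcopart q)"
    proof (rule ccontr)
      assume "\<not> coprime i (pcopart q)"
      then obtain x where "Factorial_Ring.prime x" "x dvd i" "x dvd pcopart q"
        by (metis coprime_iff_gcd_eq_1 gcd_nat.bounded_iff prime_factor_nat)
      then show False
        using only not_dvd_pcopart by blast
    qed
    then show ?thesis
      using i ppart_pcopart[of q] coprime_dvd_mult_left_iff by metis
  qed simp
  then obtain j where "ppart q = i * j"
    by blast
  then show ?thesis
    using powers_in_index[OF assms(1)] subgroup_pow_closed[OF n(2)] normal_inD(1)[OF assms(1)]
    unfolding i_def[symmetric] powers_in_def by (auto simp: subgroup.mem_carrier simp flip: nat_pow_pow)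
qed

text \<open>The contrapositive of the existence of a critical word, for the group \<open>G/N\<close> and with a
forbidden bottom letter \<open>q\<close> for which \<open>O\<^bsub>q\<^esub>(G/N)\<close> is trivial;
forbidding \<open>q\<close> makes equal neighbours avoidable in the induction. For \<open>x \<noteq>
q\<close>, the words that start with \<open>x\<close> show by induction that \<open>G\<close> has a
chain of length \<open>n\<close> above \<open>M x = O\<^bsub>x'x\<^esub>(G)\<close>, relative to
\<open>N\<close>, where \<open>x\<close> is now the forbidden letter. The intersection \<open>Y\<close>
of all these \<open>M x\<close> is nilpotent modulo \<open>N\<close>.\<close>

theorem omitting_all_words_chain:
  assumes "normal_in N (carrier G)"
    and "\<And>B. normal_in B (carrier G) \<Longrightarrow> N \<subseteq> B \<Longrightarrow> powers_in (ppart q) B N \<Longrightarrow> B \<subseteq> N"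
    and "\<And>w. length w = Suc n \<Longrightarrow> \<forall>x\<in>set w. Factorial_Ring.prime x \<Longrightarrow> distinct_adj w \<Longrightarrow>
      hd w \<noteq> q \<Longrightarrow> omits w (carrier G) N"
  shows "nilpotent_chain n N"
  using assms
proof (induction n arbitrary: N q)
  case 0
  have "powers_in (pcopart x) (carrier G) N" if "Factorial_Ring.prime x" "x \<noteq> q" for x
    using 0(3)[of "[x]"] that by simp
  then have "powers_in (ppart q) (carrier G) N"
    using powers_in_ppart_from_others[OF 0(1)] by blast
  then show ?case
    using 0(2)[OF normal_in_carrier] normal_inD(3)[OF 0(1)] by auto
next
  case (Suc n)
  note N = Suc.prems(1)
  define S where "S = prime_factors (order G) - {q}"
  have S: "finite S" "x \<in> S \<Longrightarrow> Factorial_Ring.prime x \<and> x \<noteq> q"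
      "x \<in> S \<longleftrightarrow> Factorial_Ring.prime x \<and> x dvd order G \<and> x \<noteq> q" for x
    using order_pos unfolding S_def by (auto simp: in_prime_factors_iff)
  define K where "K = (\<lambda>x. radical (pcopart x) (carrier G) N)"
  define M where "M = (\<lambda>x. radical (ppart x) (carrier G) (K x))"
  have K: "normal_in (K x) (carrier G)" if "x \<in> S" for x
    unfolding K_def using normal_in_radical[OF unitary_pcopart N] S(2)[OF that] by blast
  have M: "normal_in (M x) (carrier G)" if "x \<in> S" for x
    unfolding M_def using normal_in_radical[OF unitary_ppart K[OF that]] S(2)[OF that] by blast
  have NK: "N \<subseteq> K x" for x
    unfolding K_def using subset_radical[OF N] .
  have KM: "K x \<subseteq> M x" if "x \<in> S" for x
    unfolding M_def using subset_radical[OF K[OF that]] .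
  have chain: "nilpotent_chain n (M x)" if x: "x \<in> S" for x
  proof (rule Suc.IH[OF M[OF x], of x])
    have px: "Factorial_Ring.prime x" "x \<noteq> q"
      using S(2) x by auto
    show "B \<subseteq> M x" if "normal_in B (carrier G)" "M x \<subseteq> B" "powers_in (ppart x) B (M x)" for B
      using radical_closed[OF unitary_ppart[OF px(1)] K[OF x]] that unfolding M_def by blast
    fix w assume w: "length w = Suc n" "\<forall>x\<in>set w. Factorial_Ring.prime x" "distinct_adj w" "hd w \<noteq> x"
    then obtain y v where yv: "w = y # v"
      by (cases w) auto
    have "omits (x # w) (carrier G) N"
      using Suc.prems(3)[of "x # w"] w px yv by simp
    then have "powers_in (pcopart x) (carrier G) N \<or> omits w (carrier G) (M x)"
      using omits_radical px(1) unfolding M_def K_def by blast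
    moreover have "omits w (carrier G) (M x)" if "powers_in (pcopart x) (carrier G) N"
    proof -
      have "carrier G \<subseteq> K x"
        unfolding K_def using radical_greatest[OF normal_in_carrier normal_inD(3)[OF N] that] .
      then have "M x = carrier G"
        using KM[OF x] normal_inD(3)[OF M[OF x]] by blast
      then show ?thesis
        using omits_self[OF subgroup_self] yv by (simp del: omits.simps)
    qed
    ultimately show "omits w (carrier G) (M x)"
      by blast
  qed
  \<comment> \<open>For empty \<open>S\<close> the intersection is the whole group.\<close>
  define Y where "Y = carrier G \<inter> (\<Inter>x\<in>S. M x)"
  have "normal_in Y (carrier G) \<and> nilpotent_chain n Y"
    unfolding Y_def
    by (rule finite_Inter_induct[OF S(1)])
      (use normal_in_carrier nilpotent_chain_carrier M chain normal_in_Int nilpotent_chain_Int in auto)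
  then have Y: "normal_in Y (carrier G)" "nilpotent_chain n Y"
    by auto
  note y = normal_inD[OF Y(1)]
  \<comment> \<open>For \<open>x\<close> in \<open>S\<close>, \<open>Y\<close> is an \<open>x\<close>-group modulo \<open>K x = O\<^bsub>x'\<^esub>(G)\<close>, so \<open>Y/Z\<close> is nilpotent. On the other hand
    \<open>Z/N\<close> is an \<open>x'\<close>-group for all \<open>x \<noteq> q\<close>, that is, a normal \<open>q\<close>-subgroup, so \<open>Z = N\<close>.\<close>
  define Z where "Z = Y \<inter> (\<Inter>x\<in>S. Y \<inter> K x)"
  have YK: "normal_in (Y \<inter> K x) (carrier G)" if "x \<in> S" for x
    using normal_in_Int[OF Y(1) K[OF that]] .
  have nil: "nilpotent_section Y (Y \<inter> K x)" if x: "x \<in> S" for x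
  proof (rule p_section_nilpotent)
    show "normal_in (Y \<inter> K x) Y"
      using normal_in_between[OF YK[OF x] y(2,3)] by blast
    have "powers_in (ppart x) (M x) (K x)"
      unfolding M_def by (rule powers_in_radical)
    then show "powers_in (x ^ multiplicity x (order G)) Y (Y \<inter> K x)"
      using x subgroup_pow_closed[OF y(2)] unfolding Y_def powers_in_def ppart_def by blast
    show "Factorial_Ring.prime x"
      using S(2) x by blast
  qed
  have "normal_in Z (carrier G) \<and> nilpotent_section Y Z"
    unfolding Z_def
  proof (rule finite_Inter_induct[OF S(1)])
    show "normal_in Y (carrier G) \<and> nilpotent_section Y Y"
      using Y(1) nilpotent_section_refl[OF y(2)] by blast
    show "normal_in (Y \<inter> K x) (carrier G) \<and> nilpotent_section Y (Y \<inter> K x)" if "x \<in> S" for x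
      using YK nil that by blast
    fix A B
    assume AB: "normal_in A (carrier G) \<and> nilpotent_section Y A" "normal_in B (carrier G) \<and> nilpotent_section Y B"
    then have "A \<subseteq> Y" "normal_in (A \<inter> B) (carrier G)"
      using normal_in_Int normal_inD(3) unfolding nilpotent_section_def by auto
    moreover from this have "normal_in (A \<inter> B) (Y \<inter> Y)"
      using normal_in_between[OF _ y(2,3)] by auto
    ultimately show "normal_in (A \<inter> B) (carrier G) \<and> nilpotent_section Y (A \<inter> B)"
      using nilpotent_section_Int[of Y A Y B] AB by auto
  qed
  then have Z: "normal_in Z (carrier G)" "nilpotent_section Y Z"
    by auto
  have NZ: "N \<subseteq> Z"
    using NK KM normal_inD(3)[OF N] unfolding Z_def Y_def by blast
  have "powers_in (ppart q) Z N"
  proof (rule powers_in_ppart_from_others)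
    show "normal_in N Z"
      using normal_in_between[OF N normal_inD(2,3)[OF Z(1)] NZ] .
    fix x assume "Factorial_Ring.prime x" "x dvd order G" "x \<noteq> q"
    then have "x \<in> S"
      using S(3) by blast
    then have "Z \<subseteq> K x"
      unfolding Z_def by blast
    then show "powers_in (pcopart x) Z N"
      using powers_in_mono[OF powers_in_radical _ subset_refl] unfolding K_def by blast
  qed
  then have "Z = N"
    using Suc.prems(2)[OF Z(1) NZ] NZ by blast
  then show ?case
    using Y Z(2) by auto
qed

lemma solvable_derived:
  assumes "solvable G"
  obtains n where "(derived G ^^ n) (carrier G) = {\<one>}"
  using assms solvable_imp_trivial_derived_seq unfolding solvable_def by blast

lemma fitting_length_series:
  assumes "solvable G"
  shows "nilpotent_series G (fitting_length G) (carrier G)"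
  unfolding fitting_length_def using solvable_imp_nilpotent_series[OF assms] by (rule LeastI_ex)

text \<open>The starting point of the induction is \<open>N = {\<one>}\<close> without a forbidden letter.\<close>

theorem critical_word:
  assumes "solvable G" "carrier G \<noteq> {\<one>}"
  obtains w where "length w = fitting_length G" "\<forall>x\<in>set w. Factorial_Ring.prime x" "distinct_adj w"
    "\<not> omits w (carrier G) {\<one>}" "w \<noteq> []"
proof -
  have "fitting_length G \<noteq> 0"
  proof
    assume "fitting_length G = 0"
    then have "nilpotent_series G 0 (carrier G)"
      using fitting_length_series[OF assms(1)] by simp
    then show False
      using assms(2) by cases auto
  qed
  then obtain n where n: "fitting_length G = Suc n"
    using not0_implies_Suc by blast
  have no_chain: "\<not> nilpotent_chain n {\<one>}"
  proof
    assume "nilpotent_chain n {\<one>}"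
    then have "nilpotent_series G n (carrier G)"
      using nilpotent_chain_series[OF _ nilpotent_series.unity triv_subgroup] by fastforce
    then have "fitting_length G \<le> n"
      unfolding fitting_length_def by (rule Least_le)
    then show False
      using n by simp
  qed
  \<comment> \<open>The number \<open>0\<close> serves as a forbidden letter that does not occur: \<open>ppart 0 = 1\<close>.\<close>
  have closed: "B \<subseteq> {\<one>}" if "powers_in (ppart 0) B {\<one>}" "normal_in B (carrier G)" for B
  proof
    fix b assume b: "b \<in> B"
    then have "\<one> \<otimes> b = \<one>"
      using that(1) by (auto simp: powers_in_def ppart_def)
    moreover have "b \<in> carrier G"
      using b normal_inD(3)[OF that(2)] by blast
    ultimately show "b \<in> {\<one>}"
      by simp
  qed
  have "\<exists>w. length w = Suc n \<and> (\<forall>x\<in>set w. Factorial_Ring.prime x) \<and> distinct_adj w \<and>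
      \<not> omits w (carrier G) {\<one>}"
  proof (rule ccontr)
    assume no: "\<not> ?thesis"
    have "nilpotent_chain n {\<one>}"
    proof (rule omitting_all_words_chain[OF normal_in_one[OF subgroup_self], of 0])
      show "B \<subseteq> {\<one>}" if "normal_in B (carrier G)" "powers_in (ppart 0) B {\<one>}" for B
        using closed that by blast
      show "omits w (carrier G) {\<one>}"
        if "length w = Suc n" "\<forall>x\<in>set w. Factorial_Ring.prime x" "distinct_adj w" for w
        using no that by blast
    qed
    then show False
      using no_chain by blast
  qed
  then obtain w where w: "length w = Suc n" "\<forall>x\<in>set w. Factorial_Ring.prime x" "distinct_adj w"
      "\<not> omits w (carrier G) {\<one>}"
    by blast
  then have "w \<noteq> []"
    by auto
  then show thesis
    using that[of w] w n by simp
qed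

lemma nilpotent_series_subgroup_lift:
  assumes "nilpotent_series (G\<lparr>carrier := H\<rparr>) n K" "subgroup H G"
  shows "nilpotent_series G n K"
  using assms(1)
proof (induction rule: nilpotent_series.induct)
  case unity
  then show ?case
    using nilpotent_series.unity[of G] by simp
next
  case (extension n K L)
  then show ?case
    using nilpotent_series.extension[of G n K L] incl_subgroup[OF assms(2)] by simp
qed

lemma solvable_restrict:
  assumes "solvable G" "subgroup H G"
  shows "solvable (G\<lparr>carrier := H\<rparr>)"
proof -
  have "solvable_seq (G\<lparr>carrier := H\<rparr>) K" if "solvable_seq G K" "K \<subseteq> H" for K
    using that
  proof (induction rule: solvable_seq.induct)
    case unity
    then show ?case
      using solvable_seq.unity[of "G\<lparr>carrier := H\<rparr>"] by simp
  next
    case (extension K L)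
    have "K \<subseteq> L"
      using normal_imp_subgroup[OF extension.hyps(2)] subgroup.subset by fastforce
    then show ?case
      using solvable_seq.extension[of "G\<lparr>carrier := H\<rparr>" K L] extension subgroup_incl[OF _ assms(2)]
      by simp
  qed
  then show ?thesis
    using solvable_subgroup[OF assms(2,1)] by (simp add: solvable_def)
qed

text \<open>Otherwise \<open>H\<close> would omit the shortened word, like all words that are longer than its
Fitting length, and then \<open>G\<close> would omit \<open>w\<close>.\<close>

theorem fitting_length_prime_power_index:
  assumes "solvable G" "subgroup H G" "order G = card H * r ^ k" "Factorial_Ring.prime r"
    and "\<forall>x\<in>set w. Factorial_Ring.prime x" "\<not> omits w (carrier G) {\<one>}"
  shows "length (delete_letter r w) \<le> fitting_length (G\<lparr>carrier := H\<rparr>)"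
proof (rule ccontr)
  let ?H = "G\<lparr>carrier := H\<rparr>"
  assume not: "\<not> ?thesis"
  interpret H: fin_group ?H
    using subgroup_imp_group[OF assms(2)] finite_subgroup[OF assms(2)]
    by (simp add: fin_group_def fin_group_axioms_def)
  have "nilpotent_series ?H (fitting_length ?H) H"
    using H.fitting_length_series solvable_restrict[OF assms(1,2)] by simp
  then have "nilpotent_series G (fitting_length ?H) H"
    using nilpotent_series_subgroup_lift assms(2) by blast
  moreover have "\<forall>x\<in>set (delete_letter r w). Factorial_Ring.prime x"
    using assms(5) by (simp add: delete_letter_def)
  ultimately have "omits (delete_letter r w) H {\<one>}"
    using nilpotent_series_omits not by simp
  moreover have "H \<inter> {\<one>} = {\<one>}"
    using subgroup.one_closed[OF assms(2)] by blast
  moreover obtain n where "(derived G ^^ n) (carrier G) = {\<one>}"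
    using solvable_derived[OF assms(1)] .
  ultimately show False
    using omits_lift[OF _ assms(2-5) normal_in_one[OF subgroup_self]] assms(6) by simp
qed

end

section \<open>Counting letters\<close>

lemma length_delete_letter_Cons:
  assumes "distinct_adj (x # w)" "r \<noteq> x" "w = [] \<or> r \<noteq> hd w"
  shows "length (delete_letter r (x # w)) = Suc (length (delete_letter r w))"
  using assms by (cases w) (auto simp: delete_letter_def)

lemma length_delete_letter_Cons_ge:
  "length (delete_letter r w) \<le> length (delete_letter r (x # w))"
  by (auto simp: delete_letter_def remdups_adj_Cons split: list.splits)

text \<open>Prefixing \<open>x\<close> to a word lengthens its shortened form for all \<open>r\<close> except
\<open>x\<close> itself and the next letter: if \<open>x y x\<close> is an initial segment, then
deleting \<open>y\<close> merges the two \<open>x\<close>. Hence, compared with the length of the word,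
the sum over \<open>S\<close> loses at most two for each letter, and at most one for the last.\<close>

lemma sum_length_delete_letter:
  assumes "finite S" "distinct_adj w" "w \<noteq> []"
  shows "card S * length w + 1 \<le> (\<Sum>r\<in>S. length (delete_letter r w)) + 2 * length w"
  using assms(2,3)
proof (induction w)
  case (Cons x w)
  define T where "T = S - {x} - (if w = [] then {} else {hd w})"
  have T: "finite T" "T \<subseteq> S"
    using assms(1) by (auto simp: T_def)
  have card_T: "card S \<le> card T + (if w = [] then 1 else 2)"
  proof -
    have "card (S - {x}) \<ge> card S - 1" "card (S - {x} - {hd w}) \<ge> card (S - {x}) - 1"
      using assms(1) by (simp_all add: card_Diff_singleton_if)
    then show ?thesis
      by (auto simp: T_def)
  qed
  let ?l = "\<lambda>r. length (delete_letter r w)" and ?l' = "\<lambda>r. length (delete_letter r (x # w))"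
  have "(\<Sum>r\<in>S. ?l r) + card T = (\<Sum>r\<in>S - T. ?l r) + (\<Sum>r\<in>T. Suc (?l r))"
    using sum.subset_diff[OF T(2) assms(1), of ?l] by (simp add: sum_Suc)
  also have "\<dots> \<le> (\<Sum>r\<in>S - T. ?l' r) + (\<Sum>r\<in>T. ?l' r)"
  proof (rule add_mono)
    show "(\<Sum>r\<in>S - T. ?l r) \<le> (\<Sum>r\<in>S - T. ?l' r)"
      by (intro sum_mono length_delete_letter_Cons_ge)
    show "(\<Sum>r\<in>T. Suc (?l r)) \<le> (\<Sum>r\<in>T. ?l' r)"
    proof (rule sum_mono)
      fix r assume "r \<in> T"
      then have "r \<noteq> x" "w = [] \<or> r \<noteq> hd w"
        by (auto simp: T_def split: if_splits)
      then show "Suc (?l r) \<le> ?l' r"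
        using length_delete_letter_Cons[OF Cons.prems(1)] by simp
    qed
  qed
  also have "\<dots> = (\<Sum>r\<in>S. ?l' r)"
    using sum.subset_diff[OF T(2) assms(1), of ?l'] by simp
  finally have step: "(\<Sum>r\<in>S. ?l r) + card T \<le> (\<Sum>r\<in>S. ?l' r)" .
  show ?case
  proof (cases "w = []")
    case True
    then show ?thesis
      using step card_T by simp
  next
    case False
    then have "card S * length w + 1 \<le> (\<Sum>r\<in>S. ?l r) + 2 * length w"
      using Cons by (cases w) auto
    then show ?thesis
      using step card_T False by simp
  qed
qed simp

lemma two_letters:
  assumes "card S \<ge> 4" "distinct_adj w" "w \<noteq> []"
  shows "\<exists>p\<in>S. \<exists>q\<in>S. p \<noteq> q \<and>
    length w + 1 \<le> length (delete_letter p w) + length (delete_letter q w)"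
proof -
  obtain T where T: "T \<subseteq> S" "card T = 4" "finite T"
    using assms(1) by (meson obtain_subset_with_card_n)
  obtain a b c d where abcd: "T = {a, b, c, d}" "distinct [a, b, c, d]"
  proof -
    obtain l where l: "set l = T" "distinct l"
      using finite_distinct_list[OF T(3)] by blast
    then have "length l = 4"
      using T(2) distinct_card by metis
    then obtain a b c d where "l = [a, b, c, d]"
      by (auto simp: numeral_eq_Suc length_Suc_conv)
    then show thesis
      using that[of a b c d] l by auto
  qed
  have "2 * length w + 1 \<le> (\<Sum>r\<in>T. length (delete_letter r w))"
    using sum_length_delete_letter[OF T(3) assms(2,3)] T(2) by simp
  then have "length w + 1 \<le> length (delete_letter a w) + length (delete_letter b w) \<or>
      length w + 1 \<le> length (delete_letter c w) + length (delete_letter d w)"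
    using abcd by auto
  then show ?thesis
    using abcd T(1) by auto
qed

section \<open>Hall subgroups for the complement of a prime\<close>

context fin_group
begin

lemma subgroupI_finite:
  assumes "S \<subseteq> carrier G" "\<one> \<in> S" "\<And>a b. a \<in> S \<Longrightarrow> b \<in> S \<Longrightarrow> a \<otimes> b \<in> S"
  shows "subgroup S G"
proof (rule subgroupI)
  have pow: "a [^] (k::nat) \<in> S" if "a \<in> S" for a k
    by (induction k) (use assms that in auto)
  fix a assume a: "a \<in> S"
  then have ac: "a \<in> carrier G"
    using assms(1) by blast
  have "a [^] (order G - 1) \<otimes> a = a [^] Suc (order G - 1)"
    by simp
  also have "\<dots> = \<one>"
    using pow_order_eq_1[OF ac] order_pos by (simp del: nat_pow_Suc)
  finally have "inv a = a [^] (order G - 1)"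
    using ac by (intro inv_equality) auto
  then show "inv a \<in> S"
    using pow[OF a] by simp
qed (use assms in auto)

text \<open>Averaging over the cosets of \<open>V\<close>. Choose representatives \<open>t C\<close> of the cosets
\<open>C\<close>. For \<open>x\<close> in \<open>G\<close>, the element \<open>x t(x\<^sup>-\<^sup>1C)
t(C)\<^sup>-\<^sup>1\<close> lies in \<open>V\<close>; let \<open>D x\<close> be the product of these
elements over all \<open>C\<close>. As \<open>V\<close> is abelian, \<open>D\<close> is a crossed
homomorphism, so its kernel \<open>K\<close> is a subgroup. On \<open>V\<close> it is the
\<open>m\<close>-th power map, a bijection since \<open>m\<close> is coprime to \<open>|V|\<close>.
Therefore \<open>K\<close> meets \<open>V\<close> trivially and meets every coset of \<open>V\<close>.\<close>

theorem coprime_abelian_complement: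
  assumes V: "normal_in V (carrier G)"
    and comm_V: "\<And>a b. a \<in> V \<Longrightarrow> b \<in> V \<Longrightarrow> a \<otimes> b = b \<otimes> a"
    and ord: "order G = card V * m" "coprime (card V) m"
  shows "\<exists>K. subgroup K G \<and> K \<inter> V = {\<one>} \<and> (\<forall>x\<in>carrier G. \<exists>v\<in>V. v \<otimes> x \<in> K)"
proof -
  note v = normal_inD[OF V]
  let ?V = "G\<lparr>carrier := V\<rparr>"
  interpret V: comm_group ?V
    using subgroup_imp_group[OF v(2)] comm_V by (intro group.group_comm_groupI) auto
  have vc: "x \<in> carrier G" if "x \<in> V" for x
    using v(2) that by (rule subgroup.mem_carrier)
  define \<C> where "\<C> = rcosets V"
  have coset: "V #> x \<in> \<C>" if "x \<in> carrier G" for x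
    unfolding \<C>_def using rcosetsI[OF subgroup.subset[OF v(2)] that] .
  have coset_absorb: "V #> (w \<otimes> x) = V #> x" if "w \<in> V" "x \<in> carrier G" for w x
    using that repr_independence[of "w \<otimes> x" V x] v(2) vc by (auto simp: r_coset_def)
  define t where "t C = (SOME x. x \<in> C)" for C :: "'a set"
  have t_mem: "t C \<in> C" if "C \<in> \<C>" for C
    using that rcosets_part_G subgroup.rcosets_non_empty[OF v(2)] unfolding \<C>_def t_def
    by (metis some_in_eq)
  have t_carrier: "t C \<in> carrier G" if "C \<in> \<C>" for C
    using t_mem[OF that] that rcosets_part_G[OF v(2)] unfolding \<C>_def by blast
  have t_coset: "V #> t C = C" if C: "C \<in> \<C>" for C
  proof -
    obtain g where g: "g \<in> carrier G" "C = V #> g"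
      using C unfolding \<C>_def RCOSETS_def by blast
    then show ?thesis
      using repr_independence[of "t C" V g] t_mem[OF C] v(2) by simp
  qed
  have t_rep: "\<exists>w\<in>V. t (V #> x) = w \<otimes> x" if "x \<in> carrier G" for x
    using t_mem[OF coset[OF that]] by (auto simp: r_coset_def)
  \<comment> \<open>The permutation of the cosets induced by left multiplication with \<open>x\<close>.\<close>
  define \<rho> where "\<rho> x C = V #> (x \<otimes> t C)" for x C
  have \<rho>_coset: "\<rho> x C \<in> \<C>" if "x \<in> carrier G" "C \<in> \<C>" for x C
    unfolding \<rho>_def using coset t_carrier that by blast
  have \<rho>_mult: "\<rho> (x \<otimes> y) C = \<rho> x (\<rho> y C)" if "x \<in> carrier G" "y \<in> carrier G" "C \<in> \<C>" for x y C
  proof -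
    have tc: "t C \<in> carrier G"
      using t_carrier that by blast
    obtain w where w: "w \<in> V" "t (V #> (y \<otimes> t C)) = w \<otimes> (y \<otimes> t C)"
      using t_rep[OF m_closed[OF \<open>y \<in> carrier G\<close> tc]] by blast
    have "x \<otimes> (w \<otimes> (y \<otimes> t C)) = (x \<otimes> w \<otimes> inv x) \<otimes> (x \<otimes> y \<otimes> t C)"
      using that tc vc[OF w(1)] by (simp add: m_assoc)
    then have "\<rho> x (\<rho> y C) = V #> (x \<otimes> y \<otimes> t C)"
      unfolding \<rho>_def w(2) using coset_absorb v(4)[OF that(1) w(1)] that tc by simp
    then show ?thesis
      by (simp add: \<rho>_def)
  qed
  have \<rho>_one: "\<rho> w C = C" if "w \<in> V" "C \<in> \<C>" for w C
    unfolding \<rho>_def using coset_absorb t_coset t_carrier that by simp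
  have \<rho>_inj: "inj_on (\<rho> x) \<C>" if "x \<in> carrier G" for x
  proof (rule inj_on_inverseI)
    fix C assume "C \<in> \<C>"
    then show "\<rho> (inv x) (\<rho> x C) = C"
      using \<rho>_mult[of "inv x" x C] \<rho>_one[of \<one> C] that subgroup.one_closed[OF v(2)] by simp
  qed
  have fin: "finite \<C>"
    unfolding \<C>_def using finite_carrier rcosets_part_G[OF v(2)] by (simp add: finite_UnionD)
  have \<rho>_image: "\<rho> x ` \<C> = \<C>" if "x \<in> carrier G" for x
    using \<rho>_coset \<rho>_inj that by (intro endo_inj_surj fin) auto
  define f where "f x C = x \<otimes> t (\<rho> (inv x) C) \<otimes> inv (t C)" for x C
  have f_mem: "f x C \<in> V" if "x \<in> carrier G" "C \<in> \<C>" for x C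
  proof -
    have tc: "t C \<in> carrier G"
      using t_carrier that by blast
    obtain w where w: "w \<in> V" "t (V #> (inv x \<otimes> t C)) = w \<otimes> (inv x \<otimes> t C)"
      using t_rep[OF m_closed[OF inv_closed[OF \<open>x \<in> carrier G\<close>] tc]] by blast
    have "f x C = x \<otimes> w \<otimes> inv x"
      unfolding f_def \<rho>_def w(2) using that tc vc[OF w(1)] by (simp add: m_assoc)
    then show ?thesis
      using v(4)[OF that(1) w(1)] by simp
  qed
  have f_mult: "f (x \<otimes> y) C = (x \<otimes> f y (\<rho> (inv x) C) \<otimes> inv x) \<otimes> f x C"
    if "x \<in> carrier G" "y \<in> carrier G" "C \<in> \<C>" for x y C
  proof -
    have "\<rho> (inv x) C \<in> \<C>" "\<rho> (inv y) (\<rho> (inv x) C) \<in> \<C>"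
      using \<rho>_coset that by auto
    then have "t C \<in> carrier G" "t (\<rho> (inv x) C) \<in> carrier G"
        "t (\<rho> (inv y) (\<rho> (inv x) C)) \<in> carrier G"
      using t_carrier that by auto
    moreover have "\<rho> (inv (x \<otimes> y)) C = \<rho> (inv y) (\<rho> (inv x) C)"
      using \<rho>_mult[of "inv y" "inv x" C] that by (simp add: inv_mult_group)
    ultimately show ?thesis
      unfolding f_def using that by (simp add: m_assoc)
  qed
  define D where "D x = finprod ?V (f x) \<C>" for x
  have D_mem: "D x \<in> V" if "x \<in> carrier G" for x
    unfolding D_def using V.finprod_closed[of "f x" \<C>] f_mem that by auto
  have conj_finprod: "x \<otimes> finprod ?V g S \<otimes> inv x = finprod ?V (\<lambda>C. x \<otimes> g C \<otimes> inv x) S"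
    if "x \<in> carrier G" "finite S" "\<And>C. C \<in> S \<Longrightarrow> g C \<in> V" for x and S :: "'a set set" and g
    using that(2,3)
  proof (induction S rule: finite_induct)
    case empty
    then show ?case
      using that(1) by simp
  next
    case (insert C S)
    have "finprod ?V g S \<in> V"
      using V.finprod_closed[of g S] insert by auto
    moreover have "finprod ?V g (insert C S) = g C \<otimes> finprod ?V g S"
      using V.finprod_insert[of S C g] insert by auto
    moreover have "finprod ?V (\<lambda>C. x \<otimes> g C \<otimes> inv x) (insert C S) =
        (x \<otimes> g C \<otimes> inv x) \<otimes> finprod ?V (\<lambda>C. x \<otimes> g C \<otimes> inv x) S"
      using V.finprod_insert[of S C "\<lambda>C. x \<otimes> g C \<otimes> inv x"] insert v(4)[OF that(1)] by auto
    moreover have "g C \<in> V"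
      using insert by blast
    ultimately show ?case
      using insert conj_mult[OF that(1) vc vc] by simp
  qed
  have D_mult: "D (x \<otimes> y) = (x \<otimes> D y \<otimes> inv x) \<otimes> D x" if "x \<in> carrier G" "y \<in> carrier G" for x y
  proof -
    have shift: "finprod ?V (\<lambda>C. f y (\<rho> (inv x) C)) \<C> = D y"
      using V.finprod_reindex[of "f y" "\<rho> (inv x)" \<C>] \<rho>_image[of "inv x"] \<rho>_inj[of "inv x"] f_mem that
      unfolding D_def by auto
    have mem: "f y (\<rho> (inv x) C) \<in> V" if "C \<in> \<C>" for C
      using f_mem \<rho>_coset that \<open>x \<in> _\<close> \<open>y \<in> _\<close> by simp
    have "D (x \<otimes> y) = finprod ?V (\<lambda>C. (x \<otimes> f y (\<rho> (inv x) C) \<otimes> inv x) \<otimes> f x C) \<C>"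
      unfolding D_def using f_mult that mem f_mem v(4)[OF that(1)] subgroup.m_closed[OF v(2)]
      by (intro V.finprod_cong') auto
    also have "\<dots> = finprod ?V (\<lambda>C. x \<otimes> f y (\<rho> (inv x) C) \<otimes> inv x) \<C> \<otimes> D x"
      using V.finprod_multf[of "\<lambda>C. x \<otimes> f y (\<rho> (inv x) C) \<otimes> inv x" \<C> "f x"] mem f_mem that
        v(4)[OF that(1)] unfolding D_def by auto
    also have "finprod ?V (\<lambda>C. x \<otimes> f y (\<rho> (inv x) C) \<otimes> inv x) \<C> = x \<otimes> D y \<otimes> inv x"
      using conj_finprod[OF that(1) fin, of "\<lambda>C. f y (\<rho> (inv x) C)"] mem shift by simp
    finally show ?thesis .
  qed
  have index: "card \<C> = m"
    using lagrange[OF v(2)] ord(1) card_subgroup_pos[OF v(2)] unfolding \<C>_def by simp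
  have D_V: "D w = w [^] m" if "w \<in> V" for w
  proof -
    have "f w C = w" if "C \<in> \<C>" for C
      using \<rho>_one[of "inv w" C] that \<open>w \<in> V\<close> subgroup.m_inv_closed[OF v(2)] t_carrier[OF that] vc
      unfolding f_def by (simp add: m_assoc)
    then have "D w = finprod ?V (\<lambda>_. w) \<C>"
      unfolding D_def using that by (intro V.finprod_cong') auto
    also have "\<dots> = w [^] m"
      using V.finprod_const[of w \<C>] that index by (simp flip: nat_pow_consistent)
    finally show ?thesis .
  qed
  define K where "K = {x \<in> carrier G. D x = \<one>}"
  have "subgroup K G"
  proof (rule subgroupI_finite)
    show "\<one> \<in> K"
      using D_V[OF subgroup.one_closed[OF v(2)]] by (simp add: K_def)
    show "a \<otimes> b \<in> K" if "a \<in> K" "b \<in> K" for a b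
      using that D_mult by (simp add: K_def)
  qed (auto simp: K_def)
  moreover have "K \<inter> V = {\<one>}"
  proof -
    have "w = \<one>" if "w \<in> K" "w \<in> V" for w
    proof -
      have "w [^] m \<in> {\<one>}"
        using D_V that by (simp add: K_def)
      moreover have "w [^] card V \<in> {\<one>}"
        using V.pow_order_eq_1[of w] that by (simp add: order_def flip: nat_pow_consistent)
      ultimately have "w \<in> {\<one>}"
        using coprime_pow_mem[OF triv_subgroup] vc[OF that(2)] ord(2) by blast
      then show ?thesis
        by simp
    qed
    moreover have "\<one> \<in> K \<inter> V"
      using subgroup.one_closed calculation \<open>subgroup K G\<close> v(2) by blast
    ultimately show ?thesis
      by blast
  qed
  moreover have "\<exists>w\<in>V. w \<otimes> x \<in> K" if x: "x \<in> carrier G" for x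
  proof -
    have "m \<noteq> 0"
      using ord(1) order_pos by auto
    then obtain j y where j: "m * j = card V * y + 1"
      using bezout_nat[of m "card V"] ord(2) by (auto simp: coprime_commute)
    define d where "d = D x"
    have d: "d \<in> V" "d \<in> carrier G"
      unfolding d_def using D_mem[OF x] vc by auto
    \<comment> \<open>As \<open>j\<close> is inverse to \<open>m\<close> modulo \<open>|V|\<close>, this is the \<open>m\<close>-th root of \<open>inv d\<close> in \<open>V\<close>.\<close>
    define w where "w = (inv d) [^] j"
    have w: "w \<in> V" "w \<in> carrier G"
      unfolding w_def using subgroup_pow_closed[OF v(2) subgroup.m_inv_closed[OF v(2) d(1)]] vc by auto
    have iV: "(inv d) [^] card V = \<one>"
      using V.pow_order_eq_1[of "inv d"] subgroup.m_inv_closed[OF v(2) d(1)]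
      by (simp add: order_def flip: nat_pow_consistent)
    have "w [^] m = (inv d) [^] (card V * y + 1)"
      unfolding w_def j[symmetric] using d by (simp add: nat_pow_pow mult.commute)
    also have "\<dots> = ((inv d) [^] card V) [^] y \<otimes> inv d"
      using d by (simp add: nat_pow_pow)
    finally have wm: "w [^] m = inv d"
      using iV d by simp
    have "D (w \<otimes> x) = (w \<otimes> d \<otimes> inv w) \<otimes> inv d"
      using D_mult[OF w(2) x] D_V[OF w(1)] wm by (simp add: d_def)
    also have "w \<otimes> d \<otimes> inv w = d"
      using comm_V[OF w(1) d(1)] w d by (simp add: m_assoc)
    finally have "w \<otimes> x \<in> K"
      using w d x by (simp add: K_def)
    then show ?thesis
      using w(1) by blast
  qed
  ultimately show ?thesis
    by blast
qed

text \<open>The complement of \<open>L/N\<close> in \<open>H/N\<close>, pulled back to \<open>H\<close>.\<close>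

lemma section_complement:
  assumes L: "normal_in L H" and N: "normal_in N H" and "N \<subseteq> L"
    and comm_L: "\<And>a b. a \<in> L \<Longrightarrow> b \<in> L \<Longrightarrow> comm a b \<in> N"
    and card: "card L = card N * b" "card H = card L * c" "coprime b c"
  shows "\<exists>K. subgroup K G \<and> N \<subseteq> K \<and> K \<subseteq> H \<and> card K = card N * c"
proof -
  note l = normal_inD[OF L] and n = normal_inD[OF N]
  define Q where "Q = G\<lparr>carrier := H\<rparr> Mod N"
  note q = section_quotient[OF N, folded Q_def]
  have NL: "normal_in N L"
    using normal_in_between[OF N l(2,3) assms(3)] .
  note ql = section_quotient[OF NL]
  interpret Q: fin_group Q
    using q(1,2) finite_subgroup[OF n(1)] by (simp add: fin_group_def fin_group_axioms_def)
  define V where "V = (\<lambda>h. N #> h) ` L"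
  have "order (G\<lparr>carrier := L\<rparr> Mod N) = card V"
    unfolding order_def ql(2) V_def ..
  then have "card V = b"
    using ql(8) card(1) card_subgroup_pos[OF n(2)] by simp
  have mH: "x \<in> H" if "x \<in> L" for x
    using that l(3) by blast
  have "Q.normal_in V (carrier Q)"
  proof (rule Q.normal_inI[OF Q.subgroup_self])
    show sub: "V \<subseteq> carrier Q"
      unfolding V_def q(2) using l(3) by blast
    show "subgroup V Q"
    proof (rule Q.subgroupI_finite[OF sub])
      show "\<one>\<^bsub>Q\<^esub> \<in> V"
        unfolding V_def using subgroup.one_closed[OF l(2)] q(6,7) subgroup.one_closed[OF n(2)] n(3)
        by (metis image_eqI mH)
      fix x y assume "x \<in> V" "y \<in> V"
      then obtain a d where "a \<in> L" "x = N #> a" "d \<in> L" "y = N #> d"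
        unfolding V_def by blast
      then show "x \<otimes>\<^bsub>Q\<^esub> y \<in> V"
        using q(3)[of a d] mH subgroup.m_closed[OF l(2)] unfolding V_def by auto
    qed
    fix x y assume "x \<in> carrier Q" "y \<in> V"
    then obtain a d where a: "a \<in> H" "x = N #> a" "d \<in> L" "y = N #> d"
      unfolding V_def q(2) by blast
    then have "x \<otimes>\<^bsub>Q\<^esub> y \<otimes>\<^bsub>Q\<^esub> inv\<^bsub>Q\<^esub> x = N #> (a \<otimes> d \<otimes> inv a)"
      using q(3)[of a d] q(3)[of "a \<otimes> d" "inv a"] q(4)[of a] mH[of d]
        subgroup.m_closed[OF n(1)] subgroup.m_inv_closed[OF n(1)] by simp
    then show "x \<otimes>\<^bsub>Q\<^esub> y \<otimes>\<^bsub>Q\<^esub> inv\<^bsub>Q\<^esub> x \<in> V"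
      using l(4) a unfolding V_def by blast
  qed
  moreover have "x \<otimes>\<^bsub>Q\<^esub> y = y \<otimes>\<^bsub>Q\<^esub> x" if xy: "x \<in> V" "y \<in> V" for x y
  proof -
    obtain a d where a: "a \<in> L" "x = N #> a" "d \<in> L" "y = N #> d"
      using xy unfolding V_def by blast
    then show ?thesis
      using comm_L comm_mem_iff_section[OF N mH[OF a(1)] mH[OF a(3)]] q(3)[of a d] q(3)[of d a] mH
      by metis
  qed
  moreover have Qord: "order Q = card V * c"
    using q(8) card \<open>card V = b\<close> card_subgroup_pos[OF n(2)] by (simp add: mult.assoc)
  ultimately obtain C where C: "subgroup C Q" "C \<inter> V = {\<one>\<^bsub>Q\<^esub>}"
      "\<forall>x\<in>carrier Q. \<exists>w\<in>V. w \<otimes>\<^bsub>Q\<^esub> x \<in> C" and V: "Q.normal_in V (carrier Q)"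
    using Q.coprime_abelian_complement[of V c] card(3) \<open>card V = b\<close> by metis
  have "carrier Q \<subseteq> V <#>\<^bsub>Q\<^esub> C"
  proof
    fix x assume x: "x \<in> carrier Q"
    obtain w where w: "w \<in> V" "w \<otimes>\<^bsub>Q\<^esub> x \<in> C"
      using C(3) x by blast
    have "w \<in> carrier Q"
      using w(1) Q.normal_inD(3)[OF V] by blast
    then have "x = inv\<^bsub>Q\<^esub> w \<otimes>\<^bsub>Q\<^esub> (w \<otimes>\<^bsub>Q\<^esub> x)"
      using x Q.cancel_left(1) by metis
    then show "x \<in> V <#>\<^bsub>Q\<^esub> C"
      using w(2) subgroup.m_inv_closed[OF Q.normal_inD(2)[OF V] w(1)] unfolding Q.mem_set_mult
      by blast
  qed
  then have "V <#>\<^bsub>Q\<^esub> C = carrier Q"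
    using subgroup.subset[OF Q.product_formula(2)[OF V C(1)]] by blast
  then have "card C * card V = order Q * card (V \<inter> C)"
    using Q.product_formula(1)[OF V C(1)] by (simp add: order_def)
  moreover have "card (V \<inter> C) = 1"
    using C(2) by (simp add: Int_commute)
  ultimately have "card C = c"
    using Qord Q.card_subgroup_pos[OF Q.normal_inD(2)[OF V]] by simp
  define K where "K = {h \<in> H. N #> h \<in> C}"
  have K: "subgroup K G"
  proof (rule subgroupI_finite)
    show "K \<subseteq> carrier G"
      using subgroup.subset[OF n(1)] by (auto simp: K_def)
    show "\<one> \<in> K"
      using subgroup.one_closed[OF n(1)] subgroup.one_closed[OF C(1)] subgroup.one_closed[OF n(2)]
        q(6) q(7)[of \<one>] by (simp add: K_def)
    show "a \<otimes> d \<in> K" if "a \<in> K" "d \<in> K" for a d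
    proof -
      have "a \<in> H" "d \<in> H" "N #> a \<in> C" "N #> d \<in> C"
        using that by (auto simp: K_def)
      then show ?thesis
        using q(3)[of a d] subgroup.m_closed[OF n(1)] subgroup.m_closed[OF C(1), of "N #> a" "N #> d"]
        by (simp add: K_def)
    qed
  qed
  have KH: "K \<subseteq> H"
    by (auto simp: K_def)
  have NK: "N \<subseteq> K"
  proof
    fix h assume h: "h \<in> N"
    then have "N #> h = N"
      using n(3) q(7) by blast
    then show "h \<in> K"
      using h n(3) q(6) subgroup.one_closed[OF C(1)] by (auto simp: K_def)
  qed
  have "normal_in N K"
    using normal_in_between[OF N K KH NK] .
  note k = section_quotient[OF this]
  have "carrier (G\<lparr>carrier := K\<rparr> Mod N) = C"
  proof
    show "carrier (G\<lparr>carrier := K\<rparr> Mod N) \<subseteq> C"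
      unfolding k(2) by (auto simp: K_def)
    show "C \<subseteq> carrier (G\<lparr>carrier := K\<rparr> Mod N)"
    proof
      fix x assume "x \<in> C"
      moreover from this obtain h where "h \<in> H" "x = N #> h"
        using subgroup.subset[OF C(1)] q(2) by blast
      ultimately show "x \<in> carrier (G\<lparr>carrier := K\<rparr> Mod N)"
        unfolding k(2) by (auto simp: K_def)
    qed
  qed
  then have "card K = card N * c"
    using k(8) \<open>card C = c\<close> by (simp add: order_def mult.commute)
  then show ?thesis
    using K KH NK by blast
qed

text \<open>\<open>L/N\<close> is the \<open>q\<close>-part of an abelian normal subgroup of \<open>H/N\<close>,
which solubility provides.\<close>

lemma minimal_section:
  assumes solv: "(derived G ^^ n) (carrier G) = {\<one>}" and N: "normal_in N H" and "N \<noteq> H"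
  obtains L q b where "normal_in L H" "N \<subseteq> L" "N \<noteq> L" "Factorial_Ring.prime q"
    "card L = card N * q ^ b" "\<And>a b. a \<in> L \<Longrightarrow> b \<in> L \<Longrightarrow> comm a b \<in> N"
proof -
  note n = normal_inD[OF N]
  have "\<not> H \<subseteq> N"
    using n(3) assms(3) by blast
  then obtain D where D: "normal_in D H" "\<not> D \<subseteq> N" "derived G D \<subseteq> N"
    using solvable_chain_step[OF solv normal_in_refl[OF n(1)] n(2)] by metis
  note d = normal_inD[OF D(1)]
  note dn = set_mult_subgroup_normal_in[OF d(2,3) N]
  have DN: "normal_in (D <#> N) H"
    using normal_in_set_mult[OF D(1) N] .
  have NDN: "normal_in N (D <#> N)"
    using normal_in_between[OF N dn(1,4,3)] .
  have comm: "comm a b \<in> N" if "a \<in> D <#> N" "b \<in> D <#> N" for a b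
    using comm_mod_set_mult[OF N d(3) _ that] comm_in_derived D(3) by blast
  define i where "i = card (D <#> N) div card N"
  have "card (D <#> N) = card N * i"
    unfolding i_def using card_subgroup_dvd[OF n(2) dn(1,3)] by simp
  moreover have "N \<noteq> D <#> N"
    using dn(2) D(2) by blast
  ultimately have "i \<noteq> 1"
    using subgroup_eqI[OF n(2) dn(1,3)] by auto
  then obtain q where q: "Factorial_Ring.prime q" "q dvd i"
    using prime_factor_nat by blast
  define L where "L = {d \<in> D <#> N. d [^] ppart q \<in> N}"
  have L: "normal_in L H"
    unfolding L_def using normal_in_power_kernel[OF DN N dn(3) comm] by blast
  have NL: "N \<subseteq> L"
    using dn(3) subgroup_pow_closed[OF n(2)] by (auto simp: L_def)
  have "N \<noteq> L"
  proof
    assume NL: "N = L"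
    have "powers_in (pcopart q) (D <#> N) N"
      unfolding powers_in_def
    proof
      fix a assume a: "a \<in> D <#> N"
      then have ac: "a \<in> carrier G"
        using dn(1) by (simp add: subgroup.mem_carrier)
      have "(a [^] pcopart q) [^] ppart q = \<one>"
        using pow_order_eq_1[OF ac] ac ppart_pcopart[of q] by (simp add: nat_pow_pow mult.commute)
      then have "a [^] pcopart q \<in> L"
        using subgroup_pow_closed[OF dn(1) a] subgroup.one_closed[OF n(2)] by (simp add: L_def)
      then show "a [^] pcopart q \<in> N"
        using NL by simp
    qed
    then show False
      using prime_dvd_exponent[OF NDN _ q(1)] q not_dvd_pcopart unfolding i_def by blast
  qed
  have "powers_in (q ^ multiplicity q (order G)) L N"
    by (auto simp: powers_in_def L_def ppart_def)
  then obtain b where "card L = card N * q ^ b"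
    using index_prime_power[OF normal_in_between[OF N normal_inD(2,3)[OF L] NL] _ q(1)] by blast
  then show thesis
    using that[OF L NL \<open>N \<noteq> L\<close> q(1)] comm by (auto simp: L_def)
qed

text \<open>A complement modulo a larger subgroup \<open>L\<close> is refined: it contains the desired one if
\<open>L/N\<close> is not a \<open>p\<close>-group, and if it is a proper subgroup then induction
applies to it. In the remaining case \<open>L/N\<close> is an abelian normal \<open>p\<close>-subgroup
of \<open>p'\<close>-index and has a complement.\<close>

theorem section_p_complement:
  assumes solv: "(derived G ^^ n) (carrier G) = {\<one>}" and p: "Factorial_Ring.prime p"
    and "normal_in N H"
  shows "\<exists>K c d. subgroup K G \<and> N \<subseteq> K \<and> K \<subseteq> H \<and> card K = card N * c \<and> \<not> p dvd c
    \<and> card H = card K * p ^ d"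
  using assms(3)
proof (induction "card H - card N" arbitrary: H N rule: less_induct)
  case less
  note N = less.prems and n = normal_inD[OF less.prems]
  have mono: "card A < card B" if "A \<subset> B" "subgroup B G" for A B
    using that finite_subgroup psubset_card_mono by blast
  show ?case
  proof (cases "N = H")
    case True
    then show ?thesis
      using n p not_prime_unit
      by (intro exI[of _ N] exI[of _ 1] exI[of _ 0]) auto
  next
    case False
    obtain L q b where L: "normal_in L H" "N \<subseteq> L" "N \<noteq> L" "Factorial_Ring.prime q"
        "card L = card N * q ^ b" "\<And>a b. a \<in> L \<Longrightarrow> b \<in> L \<Longrightarrow> comm a b \<in> N"
      using minimal_section[OF solv N False] by metis
    note l = normal_inD[OF L(1)]
    have "card N < card L" "card L \<le> card H"
      using mono[of N L] L(2,3) l(2) card_mono[OF finite_subgroup[OF l(1)] l(3)] by auto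
    then have "card H - card L < card H - card N"
      by simp
    then obtain K c d where K: "subgroup K G" "L \<subseteq> K" "K \<subseteq> H" "card K = card L * c" "\<not> p dvd c"
        "card H = card K * p ^ d"
      using less.hyps[OF _ L(1)] by blast
    consider "q \<noteq> p" | "q = p" "K \<noteq> H" | "q = p" "K = H"
      by blast
    then show ?thesis
    proof cases
      case 1
      have "\<not> p dvd q ^ b"
        using 1 p L(4) prime_dvd_power primes_dvd_imp_eq by blast
      then have "\<not> p dvd q ^ b * c"
        using K(5) p prime_dvd_mult_iff by blast
      moreover have "card K = card N * (q ^ b * c)"
        using K(4) L(5) by simp
      ultimately show ?thesis
        using K L(2) by blast
    next
      case 2
      have NK: "N \<subseteq> K"
        using K(2) L(2) by blast
      have "card K < card H" "card N \<le> card K"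
        using mono[of K H] 2 K(3) n(1) card_mono[OF finite_subgroup[OF K(1)] NK] by auto
      then have "card K - card N < card H - card N"
        by simp
      then obtain K' c' d' where K': "subgroup K' G" "N \<subseteq> K'" "K' \<subseteq> K" "card K' = card N * c'"
          "\<not> p dvd c'" "card K = card K' * p ^ d'"
        using less.hyps[OF _ normal_in_between[OF N K(1,3) NK]] by blast
      then have "card H = card K' * p ^ (d' + d)"
        using K(6) by (simp add: power_add)
      then show ?thesis
        using K' K(3) by blast
    next
      case 3
      have "coprime (q ^ b) c"
        using 3 K(5) p by (simp add: prime_imp_coprime)
      then obtain K' where K': "subgroup K' G" "N \<subseteq> K'" "K' \<subseteq> H" "card K' = card N * c"
        using section_complement[OF L(1) N L(2,6,5)] K(4) 3 by blast
      then have "card H = card K' * p ^ b"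
        using K(4) 3 L(5) by simp
      then show ?thesis
        using K' K(5) by blast
    qed
  qed
qed

lemma exists_hall_p_complement:
  assumes "solvable G" "p \<in> group_primes G"
  shows "\<exists>P. hall_subgroup (group_primes G - {p}) P G"
proof -
  have p: "Factorial_Ring.prime p"
    using assms(2) by (auto simp: group_primes_def)
  obtain n where "(derived G ^^ n) (carrier G) = {\<one>}"
    using solvable_derived[OF assms(1)] .
  then obtain K c d where K: "subgroup K G" "card K = card {\<one>} * c" "\<not> p dvd c"
      "card (carrier G) = card K * p ^ d"
    using section_p_complement[OF _ p normal_in_one[OF subgroup_self]] by metis
  have "card (rcosets K) = p ^ d"
    using lagrange[OF K(1)] K(4) card_subgroup_pos[OF K(1)] by (simp add: order_def)
  then have "prime_factors (card (rcosets K)) \<subseteq> {p}"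
    using p by (auto simp: prime_factors_dvd dest: prime_dvd_power primes_dvd_imp_eq)
  moreover have "prime_factors (card K) \<subseteq> group_primes G - {p}"
  proof -
    have "\<not> p dvd card K"
      using K(2,3) by simp
    moreover have "prime_factors (card K) \<subseteq> prime_factors (order G)"
      using card_subgroup_dvd_order[OF K(1)] order_pos by (intro dvd_prime_factors) auto
    ultimately show ?thesis
      by (auto simp: group_primes_def)
  qed
  ultimately show ?thesis
    using K(1) unfolding hall_subgroup_def by blast
qed

text \<open>Every prime divisor of the index lies in \<open>group_primes G\<close> and must therefore be \<open>p\<close>.\<close>

lemma hall_p_complement_index:
  assumes "hall_subgroup (group_primes G - {p}) P G" "Factorial_Ring.prime p"
  obtains k where "subgroup P G" "order G = card P * p ^ k"
proof -
  have P: "subgroup P G"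
    using assms(1) by (simp add: hall_subgroup_def)
  define i where "i = card (rcosets P)"
  have i: "order G = card P * i"
    unfolding i_def using lagrange[OF P] by (simp add: mult.commute)
  have i0: "i \<noteq> 0"
    using i order_pos by auto
  have only: "x = p" if "Factorial_Ring.prime x" "x dvd i" for x
  proof -
    have "x \<in> prime_factors i" "x \<in> group_primes G"
      using that i i0 order_pos by (auto simp: group_primes_def in_prime_factors_iff)
    then show ?thesis
      using assms(1) unfolding hall_subgroup_def i_def by blast
  qed
  obtain j where j: "i = p ^ multiplicity p i * j" "\<not> p dvd j"
    using multiplicity_decompose'[of i p] i0 assms(2) not_prime_unit by metis
  have "j = 1"
    using only j by (metis dvd_triv_right dvd_trans prime_factor_nat)
  then have "i = p ^ multiplicity p i"
    using j(1) by simp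
  then show thesis
    using that[OF P] i by metis
qed

end

section \<open>Fitting length and Hall subgroups\<close>

theorem theoremB:
  fixes G :: "('a, 'b) monoid_scheme"
  assumes "group G" and "finite (carrier G)" and "solvable G"
    and "card (group_primes G) \<ge> 4"
  shows "\<exists>p \<in> group_primes G. \<exists>q \<in> group_primes G. p \<noteq> q \<and>
    (\<exists>P. hall_subgroup (group_primes G - {p}) P G) \<and>
    (\<exists>Q. hall_subgroup (group_primes G - {q}) Q G) \<and>
    (\<forall>P Q. hall_subgroup (group_primes G - {p}) P G \<longrightarrow>
           hall_subgroup (group_primes G - {q}) Q G \<longrightarrow>
       int (fitting_length G) \<le>
         int (fitting_length (G\<lparr>carrier := P\<rparr>)) + int (fitting_length (G\<lparr>carrier := Q\<rparr>)) - 1)"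
proof -
  interpret fin_group G
    using assms by (simp add: fin_group_def fin_group_axioms_def)
  have "carrier G \<noteq> {\<one>\<^bsub>G\<^esub>}"
    using assms(4) by (auto simp: group_primes_def order_def)
  then obtain w where w: "length w = fitting_length G" "\<forall>x\<in>set w. Factorial_Ring.prime x"
      "distinct_adj w" "\<not> omits w (carrier G) {\<one>\<^bsub>G\<^esub>}" "w \<noteq> []"
    using critical_word[OF assms(3)] by metis
  obtain p q where pq: "p \<in> group_primes G" "q \<in> group_primes G" "p \<noteq> q"
      "length w + 1 \<le> length (delete_letter p w) + length (delete_letter q w)"
    using two_letters[OF assms(4) w(3,5)] by blast
  have bound: "length (delete_letter r w) \<le> fitting_length (G\<lparr>carrier := H\<rparr>)"
    if r_mem: "r \<in> group_primes G" and hall: "hall_subgroup (group_primes G - {r}) H G" for r H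
  proof -
    have r: "Factorial_Ring.prime r"
      using r_mem by (auto simp: group_primes_def)
    obtain k where "subgroup H G" "order G = card H * r ^ k"
      using hall_p_complement_index[OF hall r] .
    then show ?thesis
      using fitting_length_prime_power_index[OF assms(3) _ _ r w(2,4)] by blast
  qed
  have "int (fitting_length G) \<le>
      int (fitting_length (G\<lparr>carrier := P\<rparr>)) + int (fitting_length (G\<lparr>carrier := Q\<rparr>)) - 1"
    if "hall_subgroup (group_primes G - {p}) P G" "hall_subgroup (group_primes G - {q}) Q G" for P Q
    using bound[OF pq(1) that(1)] bound[OF pq(2) that(2)] pq(4) w(1) by linarith
  then show ?thesis
    using pq(1-3) exists_hall_p_complement[OF assms(3)] by blast
qed

end
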